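(* Let $q$ be a prime power and $m$ a positive integer with $m+1\le q-1$. Let $JW_m^1(q)$ be the bipartite graph whose vertex set is the disjoint union of a point set $\mathfrak{P}=\mathbb{F}_q^{m+1}$ and a line set $\mathfrak{L}=\mathbb{F}_q^{m+1}$, in which a point $(p_1,\dots,p_{m+1})$ is adjacent to a line $[l_1,\dots,l_{m+1}]$ if and only if $$l_k+p_k=p_1^{k-1}l_1\ \ (2\le k\le m),\qquad l_{m+1}+p_{m+1}=p_1^{m+1}l_1 .$$ Then the distinct eigenvalues (of the adjacency matrix) of $JW_m^1(q)$ are $$\pm q,\ \pm\sqrt{(m+1)q},\ \pm\sqrt{mq},\ \dots,\ \pm\sqrt{2q},\ \pm\sqrt{q},\ 0.$$ The multiplicity of the eigenvalue $\pm\sqrt{iq}$ is $$(q-1)\binom{q}{i}\sum_{d=i}^{m-1}\sum_{k=0}^{d-i}(-1)^k\binom{q-i}{k}q^{d-i-k}+(q-1)N_i(x^{m+1},m-1)\quad\text{for }0\le i\le m-1,$$ and $(q-1)N_i(x^{m+1},m-1)$ for $i=m,m+1$.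
   Context: For integers $0\le \ell<n$ and a monic polynomial $u(x)=x^n+u_{n-1}x^{n-1}+\cdots+u_{\ell+1}x^{\ell+1}\in\mathbb{F}_q[x]$, $N_k(u(x),\ell)$ denotes the number of polynomials $v(x)=a_\ell x^\ell+\cdots+a_0\in\mathbb{F}_q[x]$ such that $u(x)+v(x)$ has exactly $k$ distinct roots in $\mathbb{F}_q$. Thus $N_i(x^{m+1},m-1)$ counts monic polynomials $x^{m+1}+a_{m-1}x^{m-1}+\cdots+a_0$ over $\mathbb{F}_q$ with exactly $i$ distinct roots in $\mathbb{F}_q$.
   Formalization: The full eigenvalue list fails, and is not claimed, for q even with m = 1, 3 or q−3, and for 3 | q with m = 2; there √(iq) with i = m or m+1 and N_i = 0 is dropped. The eigenvalue 0 has twice the stated i = 0 multiplicity, once for each sign. *)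

theory Defs
  imports
    "Jordan_Normal_Form.Spectral_Radius"
    "Graph_Theory.Pair_Digraph"
    "HOL-Library.Cardinality"
begin

(* The field F_q is a type 'a of class {finite,field}, with q = CARD('a).  Vectors
   (x_1, ..., x_{m+1}) are the extensional functions in PiE {1..m+1} (%_. UNIV), so that
   coordinates are numbered from 1. *)

definition vecs :: "nat \<Rightarrow> (nat \<Rightarrow> 'a) set" where
  "vecs n = ({1..n} \<rightarrow>\<^sub>E UNIV)"

definition JW_incident ::
  "nat \<Rightarrow> (nat \<Rightarrow> 'a::field) \<Rightarrow> (nat \<Rightarrow> 'a) \<Rightarrow> bool" where
  "JW_incident m p l \<longleftrightarrow>
     (\<forall>k\<in>{2..m}. l k + p k = p 1 ^ (k - 1) * l 1) \<and>
     l (m + 1) + p (m + 1) = p 1 ^ (m + 1) * l 1"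

(* Points are tagged with Inl and lines with Inr; an undirected edge is a pair of opposite arcs. *)

definition JW :: "nat \<Rightarrow> ((nat \<Rightarrow> 'a::field) + (nat \<Rightarrow> 'a)) pair_pre_digraph" where
  "JW m =
     \<lparr> pverts = vecs (m + 1) <+> vecs (m + 1),
       parcs = (\<Union>p\<in>vecs (m + 1). \<Union>l\<in>{l \<in> vecs (m + 1). JW_incident m p l}.
                  {(Inl p, Inr l), (Inr l, Inl p)}) \<rparr>"

lemma finite_vecs: "finite (vecs n :: (nat \<Rightarrow> 'a::finite) set)"
  by (simp add: vecs_def finite_PiE)

lemma pair_graph_JW:
  "pair_graph (JW m :: ((nat \<Rightarrow> 'a::{finite,field}) + (nat \<Rightarrow> 'a)) pair_pre_digraph)"
proof -
  let ?G = "JW m :: ((nat \<Rightarrow> 'a) + (nat \<Rightarrow> 'a)) pair_pre_digraph"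
  have fin: "finite (pverts ?G)"
    by (simp add: JW_def finite_vecs)
  have sub: "parcs ?G \<subseteq> pverts ?G \<times> pverts ?G"
    by (auto simp: JW_def)
  show ?thesis
  proof
    show "finite (pverts ?G)" by (fact fin)
    show "finite (parcs ?G)" using finite_subset[OF sub] fin by blast
    show "symmetric (with_proj ?G)"
      unfolding symmetric_def by (auto simp: JW_def intro!: symI)
  qed (use sub in \<open>auto simp: JW_def\<close>)
qed

definition adjacency_matrix :: "'v pair_pre_digraph \<Rightarrow> 'v list \<Rightarrow> real mat" where
  "adjacency_matrix G vs =
     mat (length vs) (length vs) (\<lambda>(i, j). if (vs ! i, vs ! j) \<in> parcs G then 1 else 0)"

(* N_k(u(x), l); degree v <= l includes v = 0, since degree 0 = 0. *)

definition root_count_num :: "nat \<Rightarrow> 'a::{finite,field} poly \<Rightarrow> nat \<Rightarrow> nat" where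
  "root_count_num k u l = card {v. degree v \<le> l \<and> card {x. poly (u + v) x = 0} = k}"

end

(* With the lines listed first, the square of the adjacency matrix has the block B^T B, whose entry at
   two lines l, l' counts their common points and depends only on l - l'.  Hence the additive characters
   l |-> psi(a . l) of F_q^(m+1) diagonalise it, and a direct computation gives the eigenvalue q r(a), where
   r(a) is the number of roots in F_q of a_1 + a_2 x + ... + a_m x^(m-1) + a_(m+1) x^(m+1).  So the
   characteristic polynomial is the product of the factors x^2 - q r(a), and the multiplicities count such
   polynomials by their number of roots: those of degree m+1 give N_i up to a scalar factor, those of
   smaller degree are counted by inclusion-exclusion.  Finally N_(m+1) (resp. N_m) is nonzero iff the
   coefficient of x^m vanishes for some choice of m+1 distinct roots (resp. of m distinct roots, one of them
   doubled), i.e. iff a suitable zero-sum subset of F_q exists. *)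

theory Submission
  imports Defs "HOL-Number_Theory.Cong"
begin

section \<open>Matrices indexed by lists\<close>

text \<open>The exponent m is skipped, so a nonzero polynomial of the family has degree below m, or
  degree m + 1 with roots (counted with multiplicity) summing to 0. This constraint can make the
  multiplicities for i = m and i = m + 1 vanish. In characteristic 2 two distinct elements never sum
  to 0; this rules out m + 1 = 2 distinct roots, likewise m + 1 = q - 2 of them (all of F_q sums to
  0, so the two elements left over would too), and for m = 3 the doubled root cancels and leaves two
  distinct roots with sum 0. In characteristic 3 with m = 2, the equation 2 y + z = 0 forces z = y.
  These are the parameters excluded from the full list of eigenvalues; for all others explicit
  zero-sum sets are built. The zero polynomial has q roots and is the only source of the eigenvalues
  q and -q; as i <= m + 1 < q, it never enters the other multiplicities. Characters are complex
  while the adjacency matrix is real: the diagonalisation is complex, and only the characteristic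
  polynomial is carried back.\<close>

definition lmat :: "('a \<Rightarrow> 'b \<Rightarrow> 'c) \<Rightarrow> 'a list \<Rightarrow> 'b list \<Rightarrow> 'c mat" where
  "lmat f xs ys = mat (length xs) (length ys) (\<lambda>(i, j). f (xs ! i) (ys ! j))"

lemma lmat_carrier [simp]: "lmat f xs ys \<in> carrier_mat (length xs) (length ys)"
  by (simp add: lmat_def)

lemma dim_lmat [simp]: "dim_row (lmat f xs ys) = length xs" "dim_col (lmat f xs ys) = length ys"
  by (simp_all add: lmat_def)

lemma index_lmat [simp]:
  "i < length xs \<Longrightarrow> j < length ys \<Longrightarrow> lmat f xs ys $$ (i, j) = f (xs ! i) (ys ! j)"
  by (simp add: lmat_def)

lemma lmat_cong:
  "(\<And>x y. x \<in> set xs \<Longrightarrow> y \<in> set ys \<Longrightarrow> f x y = g x y) \<Longrightarrow> lmat f xs ys = lmat g xs ys"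
  by (rule eq_matI) auto

text \<open>Indexing by list elements instead of positions turns a matrix product into a sum over a
  set of points, lines or characters.\<close>

lemma lmat_mult:
  fixes f :: "'a \<Rightarrow> 'b \<Rightarrow> 'c::semiring_0"
  assumes "distinct ys"
  shows "lmat f xs ys * lmat g ys zs = lmat (\<lambda>x z. \<Sum>y\<in>set ys. f x y * g y z) xs zs"
proof (rule eq_matI, goal_cases)
  case (1 i j)
  have "(\<Sum>k<length ys. f (xs ! i) (ys ! k) * g (ys ! k) (zs ! j)) =
      (\<Sum>y\<in>set ys. f (xs ! i) y * g y (zs ! j))"
    by (rule sum.reindex_bij_betw[OF bij_betw_nth]) (use assms in auto)
  then show ?case
    using 1 by (simp add: scalar_prod_def atLeast0LessThan)
qed auto

lemma lmat_one:
  "distinct xs \<Longrightarrow> lmat (\<lambda>x y. if x = y then 1 else 0) xs xs = 1\<^sub>m (length xs)"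
  by (rule eq_matI) (auto simp: nth_eq_iff_index_eq)

lemma lmat_map: "lmat f (map g xs) (map h ys) = lmat (\<lambda>x y. f (g x) (h y)) xs ys"
  by (rule eq_matI) auto

lemma lmat_append:
  "lmat f (xs @ ys) (xs' @ ys') =
     four_block_mat (lmat f xs xs') (lmat f xs ys') (lmat f ys xs') (lmat f ys ys')"
  by (rule eq_matI) (auto simp: nth_append)

lemma map_mat_lmat: "map_mat h (lmat f xs ys) = lmat (\<lambda>x y. h (f x y)) xs ys"
  by (rule eq_matI) auto

text \<open>Conjugation by a permutation matrix; it allows the arbitrary enumeration of the vertices
  to be rearranged.\<close>

lemma char_poly_lmat_permute:
  fixes f :: "'a \<Rightarrow> 'a \<Rightarrow> 'c::comm_ring_1"
  assumes "distinct xs" "distinct ys" "set xs = set ys"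
  shows "char_poly (lmat f xs xs) = char_poly (lmat f ys ys)"
proof (rule char_poly_similar, rule similar_matI)
  let ?I = "\<lambda>x y. if x = y then 1 else (0::'c)"
  have len: "length ys = length xs"
    using assms by (metis distinct_card)
  show "{lmat f xs xs, lmat f ys ys, lmat ?I xs ys, lmat ?I ys xs}
      \<subseteq> carrier_mat (length xs) (length xs)"
    using len by (auto intro!: carrier_matI)
  show "lmat ?I xs ys * lmat ?I ys xs = 1\<^sub>m (length xs)"
    unfolding lmat_one[OF assms(1), symmetric] lmat_mult[OF assms(2)] using assms
    by (intro lmat_cong) (simp add: if_distrib[of "\<lambda>c. c * _"] cong: if_cong)
  show "lmat ?I ys xs * lmat ?I xs ys = 1\<^sub>m (length xs)"
    unfolding len[symmetric] lmat_one[OF assms(2), symmetric] lmat_mult[OF assms(1)] using assms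
    by (intro lmat_cong) (simp add: if_distrib[of "\<lambda>c. c * _"] cong: if_cong)
  show "lmat f xs xs = lmat ?I xs ys * lmat f ys ys * lmat ?I ys xs"
    unfolding lmat_mult[OF assms(2)] using assms
    by (intro lmat_cong)
      (simp add: if_distrib[of "\<lambda>c. c * _"] if_distrib[of "\<lambda>c. _ * c"] cong: if_cong)
qed

text \<open>The columns of \<open>u\<close> are eigenvectors and \<open>v\<close> is a left inverse
  of \<open>u\<close>. Equal lengths make both square, so \<open>v\<close> is a two-sided inverse
  and completeness of the eigenvectors follows from orthogonality alone.\<close>

lemma char_poly_lmat_diagonalise:
  fixes f :: "'a \<Rightarrow> 'a \<Rightarrow> 'c::field"
  assumes dist: "distinct xs" "distinct ys" and len: "length xs = length ys"
    and inv: "\<And>a b. a \<in> set ys \<Longrightarrow> b \<in> set ys \<Longrightarrow>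
      (\<Sum>x\<in>set xs. v a x * u x b) = (if a = b then 1 else 0)"
    and eig: "\<And>x a. x \<in> set xs \<Longrightarrow> a \<in> set ys \<Longrightarrow> (\<Sum>y\<in>set xs. f x y * u y a) = ev a * u x a"
  shows "char_poly (lmat f xs xs) = (\<Prod>a\<in>set ys. [:- ev a, 1:])"
proof -
  let ?n = "length xs"
  let ?D = "lmat (\<lambda>a b. if a = b then ev a else 0) ys ys"
  have VU: "lmat v ys xs * lmat u xs ys = 1\<^sub>m ?n"
    unfolding len lmat_one[OF dist(2), symmetric] lmat_mult[OF dist(1)]
    by (intro lmat_cong) (simp add: inv)
  have UV: "lmat u xs ys * lmat v ys xs = 1\<^sub>m ?n"
    by (rule mat_mult_left_right_inverse[OF _ _ VU]) (auto intro!: carrier_matI simp: len)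
  have fU: "lmat f xs xs * lmat u xs ys = lmat u xs ys * ?D"
    unfolding lmat_mult[OF dist(1)] lmat_mult[OF dist(2)]
    by (intro lmat_cong)
      (simp add: eig if_distrib[of "\<lambda>c. _ * c"] mult.commute cong: if_cong)
  have car: "lmat f xs xs \<in> carrier_mat ?n ?n" "lmat u xs ys \<in> carrier_mat ?n ?n"
    "lmat v ys xs \<in> carrier_mat ?n ?n" "?D \<in> carrier_mat ?n ?n"
    by (auto intro!: carrier_matI simp: len)
  have "similar_mat (lmat f xs xs) ?D"
  proof (rule similar_matI)
    show "lmat f xs xs = lmat u xs ys * ?D * lmat v ys xs"
      using fU assoc_mult_mat[OF car(1,2,3)] UV car by simp
  qed (use car VU UV in auto)
  then have "char_poly (lmat f xs xs) = char_poly ?D"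
    by (rule char_poly_similar)
  also have "\<dots> = (\<Prod>a\<leftarrow>diag_mat ?D. [:- a, 1:])"
    by (rule char_poly_upper_triangular[of _ "length ys"])
      (auto simp: upper_triangular_def nth_eq_iff_index_eq[OF dist(2)])
  also have "diag_mat ?D = map ev ys"
    by (rule nth_equalityI) (auto simp: diag_mat_def)
  also have "(\<Prod>a\<leftarrow>map ev ys. [:- a, 1:]) = (\<Prod>a\<in>set ys. [:- ev a, 1:])"
    using dist(2) by (simp add: prod.distinct_set_conv_list o_def)
  finally show ?thesis .
qed

text \<open>The lower left block commutes with the scalar block x I, so the determinant is det (x^2
  I - B C), without dividing by x. Substituting x^2 for x is a ring homomorphism and commutes with
  the determinant.\<close>

lemma char_poly_block_antidiagonal:
  fixes B C :: "'a::idom mat"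
  assumes B: "B \<in> carrier_mat n n" and C: "C \<in> carrier_mat n n"
  shows "char_poly (four_block_mat (0\<^sub>m n n) B C (0\<^sub>m n n)) = char_poly (B * C) \<circ>\<^sub>p [:0, 0, 1:]"
proof -
  let ?h = "map_mat (\<lambda>a. [:- a:])"
  let ?k = "map_mat (\<lambda>a. [:a:])"
  let ?X = "[:0, 1:] \<cdot>\<^sub>m 1\<^sub>m n :: 'a poly mat"
  have hB: "?h B \<in> carrier_mat n n" and hC: "?h C \<in> carrier_mat n n"
    using B C by auto
  have X: "?X \<in> carrier_mat n n"
    by simp
  have h: "?h M = - ?k M" for M :: "'a mat"
    by (rule eq_matI) auto
  have "?h C * ?X = ?X * ?h C"
    using hC by (simp add: mult_smult_distrib[OF hC, of "1\<^sub>m n" n] mult_smult_assoc_mat[of "1\<^sub>m n" n n])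
  then have "det (four_block_mat ?X (?h B) (?h C) ?X) = det (?X * ?X - ?h B * ?h C)"
    by (intro det_four_block_mat[OF X hB hC X])
  moreover have "four_block_mat ?X (?h B) (?h C) ?X =
      char_poly_matrix (four_block_mat (0\<^sub>m n n) B C (0\<^sub>m n n))"
    using B C by (intro eq_matI) (auto simp: char_poly_matrix_def)
  moreover have "?X * ?X - ?h B * ?h C = map_mat (\<lambda>p. p \<circ>\<^sub>p [:0, 0, 1:]) (char_poly_matrix (B * C))"
  proof -
    have "?h B * ?h C = ?k (B * C)"
      unfolding h map_poly_mult(1)[OF B C] using B C by simp
    moreover have "?X * ?X = [:0, 0, 1:] \<cdot>\<^sub>m 1\<^sub>m n"
      by (rule eq_matI) (auto simp: mult_smult_distrib[OF X, of "1\<^sub>m n" n])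
    ultimately show ?thesis
      using B C
      by (intro eq_matI) (auto simp: char_poly_matrix_def pcompose_add pcompose_pCons)
  qed
  ultimately show ?thesis
    unfolding char_poly_def by (simp add: comm_ring_hom.hom_det[OF pcompose_hom.comm_ring_hom_axioms])
qed

section \<open>Additive characters of a finite field\<close>

text \<open>Bezout modulo the characteristic: inverses in the prime field are again multiples of 1,
  so a set closed under addition permits division by them.\<close>

lemma ex_of_nat_inverse:
  fixes k :: nat
  assumes "of_nat k \<noteq> (0 :: 'a::{finite,field})"
  shows "\<exists>i. of_nat i * of_nat k = (1::'a)"
proof -
  have "prime CHAR('a)"
    by (rule prime_CHAR_semidom) (simp add: finite_imp_CHAR_pos)
  moreover have "\<not> CHAR('a) dvd k"
    using assms by (simp add: of_nat_eq_0_iff_char_dvd)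
  ultimately have "coprime k CHAR('a)"
    by (subst coprime_commute) (rule prime_imp_coprime)
  then obtain i where "[k * i = Suc 0] (mod CHAR('a))"
    using cong_solve_coprime_nat by blast
  then have "of_nat (k * i) = (of_nat (Suc 0) :: 'a)"
    by (subst of_nat_eq_iff_cong_CHAR)
  then show ?thesis
    by (intro exI[of _ i]) (simp add: mult.commute)
qed

text \<open>A maximal additive subgroup \<open>H\<close> not containing \<open>1\<close> is a complement of the prime field, which
  carries the character \<open>j \<mapsto> w\<^sup>j\<close> for a nontrivial root of unity \<open>w\<close> of order \<open>CHAR('a)\<close>.\<close>

lemma ex_nontrivial_additive_character:
  "\<exists>\<psi> :: 'a::{finite,field} \<Rightarrow> complex.
     \<psi> 0 = 1 \<and> (\<forall>x y. \<psi> (x + y) = \<psi> x * \<psi> y) \<and> (\<exists>x. \<psi> x \<noteq> 1)"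
proof -
  let ?p = "CHAR('a)"
  \<comment> \<open>Negation is covered by addition: \<open>- h\<close> is the multiple
    \<open>of_nat (?p - 1) * h\<close>.\<close>
  define adm where
    "adm H \<longleftrightarrow> (0::'a) \<in> H \<and> (\<forall>x\<in>H. \<forall>y\<in>H. x + y \<in> H) \<and> 1 \<notin> H" for H
  have "prime ?p"
    by (rule prime_CHAR_semidom) (simp add: finite_imp_CHAR_pos)
  then have p2: "?p \<ge> 2"
    by (rule prime_ge_2_nat)
  have "{0} \<in> {H. adm H}"
    by (simp add: adm_def)
  then obtain H where H: "adm H" and max: "\<And>K. adm K \<Longrightarrow> H \<subseteq> K \<Longrightarrow> K = H"
    using finite_has_maximal2[of "{H. adm H}" "{0}"] by auto
  have H0: "0 \<in> H" and Hadd: "\<And>x y. x \<in> H \<Longrightarrow> y \<in> H \<Longrightarrow> x + y \<in> H" and H1: "1 \<notin> H"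
    using H by (auto simp: adm_def)
  have Hmult: "of_nat k * h \<in> H" if "h \<in> H" for h and k :: nat
    by (induction k) (auto simp: H0 distrib_right intro: Hadd that)
  have neg1: "of_nat (?p - 1) = (-1 :: 'a)"
    using p2 by simp
  have Hneg: "- h \<in> H" if "h \<in> H" for h
    using Hmult[OF that, of "?p - 1"] unfolding neg1 by simp
  have Hnat: "of_nat k = (0::'a)" if k: "of_nat k \<in> H" for k :: nat
  proof (rule ccontr)
    assume "of_nat k \<noteq> (0::'a)"
    then obtain i where "of_nat i * of_nat k = (1::'a)"
      using ex_of_nat_inverse by blast
    with Hmult[OF k, of i] H1 show False
      by simp
  qed
  have decomp: "\<exists>j::nat. x - of_nat j \<in> H" for x
  proof (cases "x \<in> H")
    case True
    then show ?thesis
      by (intro exI[of _ 0]) simp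
  next
    case False
    \<comment> \<open>\<open>K\<close> is generated by \<open>H\<close> and \<open>x\<close>, so by
      maximality it contains 1; the resulting equation 1 = h + k x is then solved for
      \<open>x\<close>.\<close>
    define K where "K = {h + of_nat k * x |h k. h \<in> H}"
    have sub: "H \<subseteq> K"
      unfolding K_def by (force intro: exI[of _ 0])
    have "x = 0 + of_nat 1 * x"
      by simp
    then have "x \<in> K"
      unfolding K_def using H0 by blast
    then have "\<not> adm K"
      using max sub False by blast
    moreover have "a + b \<in> K" if "a \<in> K" "b \<in> K" for a b
    proof -
      from that obtain h k h' k' where "a = h + of_nat k * x" "b = h' + of_nat k' * x" "h \<in> H" "h' \<in> H"
        unfolding K_def by blast
      then have "a + b = (h + h') + of_nat (k + k') * x" "h + h' \<in> H"
        by (simp_all add: algebra_simps Hadd)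
      then show ?thesis
        unfolding K_def by blast
    qed
    ultimately have "1 \<in> K"
      using sub H0 by (auto simp: adm_def)
    then obtain h k where hk: "h \<in> H" "1 = h + of_nat k * x"
      unfolding K_def by blast
    with H1 have "of_nat k \<noteq> (0::'a)"
      by auto
    then obtain i where i: "of_nat i * of_nat k = (1::'a)"
      using ex_of_nat_inverse by blast
    have "x = of_nat i * (of_nat k * x)"
      using i by (simp flip: mult.assoc)
    also have "of_nat k * x = 1 - h"
      using hk by (simp add: algebra_simps)
    finally have "x - of_nat i = - (of_nat i * h)"
      by (simp add: algebra_simps)
    then show ?thesis
      using Hneg Hmult hk(1) by (intro exI[of _ i]) simp
  qed
  have unique: "[j = j'] (mod ?p)" if "x - of_nat j \<in> H" "x - of_nat j' \<in> H" for x and j j' :: nat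
  proof -
    have diff: "of_nat (j + (?p - 1) * j') = (of_nat j - of_nat j' :: 'a)"
      unfolding of_nat_add of_nat_mult neg1 by simp
    have "of_nat j - of_nat j' = - (x - of_nat j) + (x - of_nat j')"
      by simp
    also have "\<dots> \<in> H"
      using that by (intro Hadd Hneg)
    finally have "of_nat (j + (?p - 1) * j') \<in> H"
      unfolding diff .
    then have "of_nat (j + (?p - 1) * j') = (0::'a)"
      by (rule Hnat)
    then have "of_nat j = (of_nat j' :: 'a)"
      unfolding diff by simp
    then show ?thesis
      by (simp add: of_nat_eq_iff_cong_CHAR)
  qed
  obtain w :: complex where w: "w ^ ?p = 1" "w \<noteq> 1"
  proof -
    have "card {z::complex. z ^ ?p = 1} = ?p"
      using p2 by (intro card_roots_unity_eq) simp
    then have "\<not> {z::complex. z ^ ?p = 1} \<subseteq> {1}"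
      using p2 card_mono[of "{1::complex}" "{z. z ^ ?p = 1}"] by auto
    then show ?thesis
      using that by blast
  qed
  have w_cong: "w ^ j = w ^ j'" if "[j = j'] (mod ?p)" for j j'
  proof -
    have "w ^ k = w ^ (k mod ?p)" for k
    proof -
      have "w ^ k = w ^ (?p * (k div ?p) + k mod ?p)"
        by simp
      then show ?thesis
        by (simp only: power_add power_mult w(1) power_one mult_1)
    qed
    from this[of j] this[of j'] show ?thesis
      using that by (simp add: cong_def)
  qed
  \<comment> \<open>Any two admissible exponents are congruent modulo \<open>?p\<close>, so
    \<open>w ^ J x\<close> does not depend on the choice.\<close>
  define J where "J x = (SOME j. x - of_nat j \<in> H)" for x
  have J: "x - of_nat (J x) \<in> H" for x
    unfolding J_def by (rule someI_ex[OF decomp])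
  have val: "w ^ J x = w ^ j" if "x - of_nat j \<in> H" for x j
    using unique[OF J that] by (rule w_cong)
  have "w ^ J 0 = 1"
    using val[of 0 0] H0 by simp
  moreover have "w ^ J (x + y) = w ^ J x * w ^ J y" for x y
  proof -
    have "(x + y) - of_nat (J x + J y) = (x - of_nat (J x)) + (y - of_nat (J y))"
      by simp
    also have "\<dots> \<in> H"
      by (rule Hadd[OF J J])
    finally have "w ^ J (x + y) = w ^ (J x + J y)"
      by (rule val)
    then show ?thesis
      by (simp add: power_add)
  qed
  moreover have "w ^ J 1 \<noteq> 1"
    using val[of 1 1] H0 w(2) by simp
  ultimately show ?thesis
    by (intro exI[of _ "\<lambda>x. w ^ J x"] conjI allI exI[of _ 1])
qed

section \<open>Orthogonality of additive characters\<close>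

locale additive_character =
  fixes \<psi> :: "'a::{finite,field} \<Rightarrow> complex"
  assumes zero: "\<psi> 0 = 1"
    and add: "\<psi> (x + y) = \<psi> x * \<psi> y"
    and nontrivial: "\<exists>x. \<psi> x \<noteq> 1"
begin

lemma sum: "\<psi> (\<Sum>i\<in>I. f i) = (\<Prod>i\<in>I. \<psi> (f i))"
  by (induction I rule: infinite_finite_induct) (auto simp: zero add)

text \<open>For nonzero \<open>c\<close>, the shift of \<open>t\<close> by \<open>x / c\<close>
  permutes the field and multiplies the sum by \<open>\<psi> x\<close>, which can be chosen
  different from 1.\<close>

lemma sum_mult: "(\<Sum>t\<in>UNIV. \<psi> (c * t)) = (if c = 0 then of_nat CARD('a) else 0)"
proof (cases "c = 0")
  case False
  obtain x where x: "\<psi> x \<noteq> 1"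
    using nontrivial by blast
  let ?S = "\<Sum>t\<in>UNIV. \<psi> (c * t)"
  have "?S = (\<Sum>t\<in>UNIV. \<psi> (c * (t + x / c)))"
    by (rule sum.reindex_bij_witness[of _ "\<lambda>t. t + x / c" "\<lambda>t. t - x / c"]) auto
  also have "\<dots> = ?S * \<psi> x"
    using False by (simp add: distrib_left add sum_distrib_right)
  finally show ?thesis
    using False x by simp
qed (simp add: zero)

lemma sum_vecs:
  "(\<Sum>l\<in>vecs n. \<psi> (\<Sum>k=1..n. a k * l k)) = (if \<forall>k\<in>{1..n}. a k = 0 then of_nat CARD('a) ^ n else 0)"
proof -
  have "(\<Sum>l\<in>vecs n. \<psi> (\<Sum>k=1..n. a k * l k)) = (\<Prod>k=1..n. \<Sum>t\<in>UNIV. \<psi> (a k * t))"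
    unfolding sum vecs_def by (rule prod_sum_PiE[symmetric]) auto
  then show ?thesis
    by (auto simp: sum_mult)
qed

end

section \<open>The characteristic polynomial of the graph\<close>

text \<open>The power of \<open>p 1\<close> attached to coordinate \<open>k\<close>: 0, ..., m - 1,
  then m + 1. Exponent 0 at coordinate 1 lets \<open>l 1\<close> be treated like the others.\<close>

definition JW_exp :: "nat \<Rightarrow> nat \<Rightarrow> nat" where
  "JW_exp m k = (if k = m + 1 then m + 1 else k - 1)"

definition JW_poly :: "nat \<Rightarrow> (nat \<Rightarrow> 'a::field) \<Rightarrow> 'a poly" where
  "JW_poly m a = (\<Sum>k=1..m + 1. monom (a k) (JW_exp m k))"

lemma poly_JW_poly: "poly (JW_poly m a) x = (\<Sum>k=1..m + 1. a k * x ^ JW_exp m k)"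
  by (simp add: JW_poly_def poly_sum poly_monom)

lemma JW_incident_iff:
  assumes "1 \<le> m"
  shows "JW_incident m p l \<longleftrightarrow> (\<forall>k\<in>{2..m + 1}. l k + p k = p 1 ^ JW_exp m k * l 1)"
proof -
  have "{2..m + 1} = insert (m + 1) {2..m}"
    using assms by auto
  then show ?thesis
    by (auto simp: JW_incident_def JW_exp_def)
qed

lemma sum_from_1: "(\<Sum>k=1..m + 1. f k) = f 1 + (\<Sum>k=2..m + 1. f k)"
  for f :: "nat \<Rightarrow> 'a::comm_monoid_add"
  by (subst sum.atLeast_Suc_atMost) (auto simp: numeral_2_eq_2)

lemma JW_exp_1 [simp]: "1 \<le> m \<Longrightarrow> JW_exp m (Suc 0) = 0"
  by (simp add: JW_exp_def)

text \<open>The first coordinate of a line through \<open>p\<close> is free and determines the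
  others by the incidence equations.\<close>

lemma sum_lines_on_point:
  fixes p :: "nat \<Rightarrow> 'a::{finite,field}" and h :: "(nat \<Rightarrow> 'a) \<Rightarrow> 'b::comm_monoid_add"
  assumes m: "1 \<le> m" and p: "p \<in> vecs (m + 1)"
  shows "(\<Sum>l | l \<in> vecs (m + 1) \<and> JW_incident m p l. h l) =
    (\<Sum>t\<in>UNIV. h (\<lambda>k\<in>{1..m + 1}. if k = 1 then t else p 1 ^ JW_exp m k * t - p k))"
  by (rule sum.reindex_bij_witness
      [of _ "\<lambda>t. \<lambda>k\<in>{1..m + 1}. if k = 1 then t else p 1 ^ JW_exp m k * t - p k" "\<lambda>l. l 1"])
    (use m p in \<open>auto simp: JW_incident_iff vecs_def fun_eq_iff PiE_iff extensional_def algebra_simps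
      intro!: arg_cong[of _ _ h]\<close>)

lemma sum_points_on_line:
  fixes l :: "nat \<Rightarrow> 'a::{finite,field}" and h :: "(nat \<Rightarrow> 'a) \<Rightarrow> 'b::comm_monoid_add"
  assumes m: "1 \<le> m" and l: "l \<in> vecs (m + 1)"
  shows "(\<Sum>p | p \<in> vecs (m + 1) \<and> JW_incident m p l. h p) =
    (\<Sum>x\<in>UNIV. h (\<lambda>k\<in>{1..m + 1}. if k = 1 then x else x ^ JW_exp m k * l 1 - l k))"
  by (rule sum.reindex_bij_witness
      [of _ "\<lambda>x. \<lambda>k\<in>{1..m + 1}. if k = 1 then x else x ^ JW_exp m k * l 1 - l k" "\<lambda>p. p 1"])
    (use m l in \<open>auto simp: JW_incident_iff vecs_def fun_eq_iff PiE_iff extensional_def algebra_simps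
      intro!: arg_cong[of _ _ h]\<close>)

context additive_character
begin

text \<open>Along the lines through \<open>p\<close>, a . l is a constant plus f(p_1) t with f =
  \<open>JW_poly m a\<close>, so orthogonality kills the sum unless \<open>p 1\<close> is a root of
  f.\<close>

lemma sum_lines_on_point:
  assumes m: "1 \<le> m" and p: "p \<in> vecs (m + 1)"
  shows "(\<Sum>l | l \<in> vecs (m + 1) \<and> JW_incident m p l. \<psi> (\<Sum>k=1..m + 1. a k * l k)) =
    (if poly (JW_poly m a) (p 1) = 0 then of_nat CARD('a) * \<psi> (- (\<Sum>k=2..m + 1. a k * p k)) else 0)"
proof -
  have eq: "(\<Sum>k=1..m + 1. a k * (\<lambda>k\<in>{1..m + 1}. if k = 1 then t else p 1 ^ JW_exp m k * t - p k) k) =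
      - (\<Sum>k=2..m + 1. a k * p k) + poly (JW_poly m a) (p 1) * t" for t
    unfolding poly_JW_poly sum_from_1 using m
    by (simp add: algebra_simps sum_distrib_left sum_subtractf)
  show ?thesis
    unfolding sum_lines_on_point[OF assms] eq add sum_distrib_left[symmetric] sum_mult by simp
qed

text \<open>After summing over the lines through each point, only points of \<open>l\<close> whose
  first coordinate x is a root of f survive. For these, minus the sum of a_k p_k over k >= 2 is a .
  l - f(x) l_1 = a . l, so each root contributes q times the value at \<open>l\<close>.\<close>

lemma eigenfunction_common_points:
  assumes m: "1 \<le> m" and l: "l \<in> vecs (m + 1)"
  shows "(\<Sum>l'\<in>vecs (m + 1). (\<Sum>p\<in>vecs (m + 1). of_bool (JW_incident m p l) * of_bool (JW_incident m p l'))
      * \<psi> (\<Sum>k=1..m + 1. a k * l' k)) =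
    of_nat (CARD('a) * card {x. poly (JW_poly m a) x = 0}) * \<psi> (\<Sum>k=1..m + 1. a k * l k)"
    (is "?lhs = ?rhs")
proof -
  let ?f = "poly (JW_poly m a)"
  let ?V = "vecs (m + 1) :: (nat \<Rightarrow> 'a) set"
  have "?lhs = (\<Sum>l'\<in>?V. \<Sum>p\<in>?V. of_bool (JW_incident m p l) *
      (of_bool (JW_incident m p l') * \<psi> (\<Sum>k=1..m + 1. a k * l' k)))"
    by (simp add: sum_distrib_right mult.assoc)
  also have "\<dots> = (\<Sum>p\<in>?V. of_bool (JW_incident m p l) *
      (\<Sum>l'\<in>?V. of_bool (JW_incident m p l') * \<psi> (\<Sum>k=1..m + 1. a k * l' k)))"
    unfolding sum_distrib_left by (rule sum.swap)
  also have "\<dots> = (\<Sum>p\<in>?V. of_bool (JW_incident m p l) *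
      (\<Sum>l' | l' \<in> ?V \<and> JW_incident m p l'. \<psi> (\<Sum>k=1..m + 1. a k * l' k)))"
    by (simp add: of_bool_def if_distrib[of "\<lambda>c. c * _"] sum.inter_filter finite_vecs cong: if_cong)
  also have "\<dots> = (\<Sum>p | p \<in> ?V \<and> JW_incident m p l.
      (\<Sum>l' | l' \<in> ?V \<and> JW_incident m p l'. \<psi> (\<Sum>k=1..m + 1. a k * l' k)))"
    by (simp add: of_bool_def if_distrib[of "\<lambda>c. c * _"] sum.inter_filter finite_vecs cong: if_cong)
  also have "\<dots> = (\<Sum>p | p \<in> ?V \<and> JW_incident m p l.
      if ?f (p 1) = 0 then of_nat CARD('a) * \<psi> (- (\<Sum>k=2..m + 1. a k * p k)) else 0)"
    using sum_lines_on_point[OF m] by (intro sum.cong) auto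
  also have "\<dots> = (\<Sum>x\<in>UNIV. if ?f x = 0 then of_nat CARD('a) * \<psi> (\<Sum>k=1..m + 1. a k * l k) else 0)"
  proof -
    have "- (\<Sum>k=2..m + 1. a k * (\<lambda>k\<in>{1..m + 1}. if k = 1 then x else x ^ JW_exp m k * l 1 - l k) k) =
        (\<Sum>k=1..m + 1. a k * l k)" if "?f x = 0" for x
    proof -
      have "- (\<Sum>k=2..m + 1. a k * (\<lambda>k\<in>{1..m + 1}. if k = 1 then x else x ^ JW_exp m k * l 1 - l k) k) =
          (\<Sum>k=1..m + 1. a k * l k) - ?f x * l 1"
        unfolding poly_JW_poly sum_from_1 using m
        by (simp add: algebra_simps sum_distrib_left sum_subtractf)
      then show ?thesis
        by (simp add: that)
    qed
    then show ?thesis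
      unfolding sum_points_on_line[OF assms] by (intro sum.cong) auto
  qed
  also have "\<dots> = ?rhs"
    by (simp add: sum.If_cases)
  finally show ?thesis .
qed

end

lemma char_poly_common_points:
  fixes ls :: "(nat \<Rightarrow> 'a::{finite,field}) list"
  assumes m: "1 \<le> m" and ls: "distinct ls" "set ls = vecs (m + 1)"
  shows "char_poly (lmat (\<lambda>l l'. \<Sum>p\<in>vecs (m + 1).
      of_bool (JW_incident m p l) * of_bool (JW_incident m p l') :: real) ls ls) =
    (\<Prod>a\<in>vecs (m + 1). [:- real (CARD('a) * card {x::'a. poly (JW_poly m a) x = 0}), 1:])"
    (is "char_poly (lmat ?g ls ls) = ?R")
proof -
  obtain \<psi> :: "'a \<Rightarrow> complex" where "additive_character \<psi>"
    using ex_nontrivial_additive_character unfolding additive_character_def by metis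
  then interpret additive_character \<psi> .
  interpret of_real_poly_hom: map_poly_inj_idom_hom complex_of_real ..
  let ?q = "of_nat CARD('a) :: complex"
  let ?u = "\<lambda>l a. \<psi> (\<Sum>k=1..m + 1. a k * l k)"
  \<comment> \<open>Inverse characters, normalised by the number q^(m+1) of lines: the inverse of
    the character table.\<close>
  let ?v = "\<lambda>a l. inverse (?q ^ (m + 1)) * \<psi> (\<Sum>k=1..m + 1. - a k * l k)"
  let ?ev = "\<lambda>a. of_nat (CARD('a) * card {x::'a. poly (JW_poly m a) x = 0}) :: complex"
  have normalise: "inverse c * (if P then c else 0) = (if P then 1 else 0)" if "c \<noteq> 0"
    for c :: complex and P
    using that by simp
  have of_bool: "complex_of_real (of_bool P) = of_bool P" for P
    by simp
  have "char_poly (lmat (\<lambda>l l'. complex_of_real (?g l l')) ls ls) = (\<Prod>a\<in>set ls. [:- ?ev a, 1:])"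
  proof (rule char_poly_lmat_diagonalise[where u = ?u and v = ?v])
    fix a b assume ab: "a \<in> set ls" "b \<in> set ls"
    have "(\<Sum>x\<in>set ls. ?v a x * ?u x b) =
        inverse (?q ^ (m + 1)) * (\<Sum>x\<in>vecs (m + 1). \<psi> (\<Sum>k=1..m + 1. (b k - a k) * x k))"
      unfolding ls sum_distrib_left mult.assoc add[symmetric] sum.distrib[symmetric]
      by (intro sum.cong arg_cong2[of _ _ _ _ "(*)"] arg_cong[of _ _ \<psi>]) (auto simp: algebra_simps)
    also have "\<dots> = (if \<forall>k\<in>{1..m + 1}. b k = a k then 1 else 0)"
      unfolding sum_vecs right_minus_eq by (rule normalise) simp
    also have "(\<forall>k\<in>{1..m + 1}. b k = a k) \<longleftrightarrow> a = b"
      using ab unfolding ls vecs_def by (metis PiE_ext)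
    finally show "(\<Sum>x\<in>set ls. ?v a x * ?u x b) = (if a = b then 1 else 0)" .
  next
    fix l a assume "l \<in> set ls"
    then show "(\<Sum>l'\<in>set ls. complex_of_real (?g l l') * ?u l' a) = ?ev a * ?u l a"
      using eigenfunction_common_points[OF m, of l a] ls by (simp add: of_bool)
  qed (use ls in auto)
  also have "lmat (\<lambda>l l'. complex_of_real (?g l l')) ls ls = map_mat complex_of_real (lmat ?g ls ls)"
    by (simp add: map_mat_lmat)
  also have "char_poly \<dots> = map_poly complex_of_real (char_poly (lmat ?g ls ls))"
    by (rule of_real_hom.char_poly_hom[OF lmat_carrier])
  also have "(\<Prod>a\<in>set ls. [:- ?ev a, 1:]) = map_poly complex_of_real ?R"
    unfolding ls of_real_poly_hom.hom_prod by (intro prod.cong) auto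
  finally show ?thesis
    by (rule of_real_poly_hom.injectivity)
qed

lemma char_poly_JW:
  fixes vs :: "((nat \<Rightarrow> 'a::{finite,field}) + (nat \<Rightarrow> 'a)) list"
  assumes m: "1 \<le> m" and vs: "distinct vs" "set vs = pverts (JW m)"
  shows "char_poly (adjacency_matrix (JW m) vs) =
    (\<Prod>a\<in>vecs (m + 1). [:- real (CARD('a) * card {x::'a. poly (JW_poly m a) x = 0}), 0, 1:])"
proof -
  obtain ls where ls: "distinct ls" "set ls = (vecs (m + 1) :: (nat \<Rightarrow> 'a) set)"
    using finite_distinct_list[OF finite_vecs] by metis
  let ?n = "length ls"
  \<comment> \<open>Points and lines are the same set of vectors, so one list enumerates both and
    all four blocks are square.\<close>
  let ?vs = "map Inr ls @ map Inl ls"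
  let ?e = "\<lambda>u v. if (u, v) \<in> parcs (JW m :: ((nat \<Rightarrow> 'a) + _) pair_pre_digraph) then 1 else 0 :: real"
  let ?B = "lmat (\<lambda>l p. of_bool (JW_incident m p l)) ls ls :: real mat"
  let ?C = "lmat (\<lambda>p l. of_bool (JW_incident m p l)) ls ls :: real mat"
  have "char_poly (adjacency_matrix (JW m) vs) = char_poly (lmat ?e vs vs)"
    by (simp add: adjacency_matrix_def lmat_def)
  also have "\<dots> = char_poly (lmat ?e ?vs ?vs)"
    by (rule char_poly_lmat_permute)
      (use vs ls in \<open>auto simp: distinct_map JW_def inj_on_def\<close>)
  also have "lmat ?e ?vs ?vs = four_block_mat (0\<^sub>m ?n ?n) ?B ?C (0\<^sub>m ?n ?n)"
    unfolding lmat_append lmat_map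
    by (intro arg_cong4[of _ _ _ _ _ _ _ _ four_block_mat] eq_matI)
      (use ls(2) in \<open>auto simp: JW_def dest: nth_mem\<close>)
  also have "char_poly \<dots> = char_poly (?B * ?C) \<circ>\<^sub>p [:0, 0, 1:]"
    by (rule char_poly_block_antidiagonal) (rule lmat_carrier)+
  also have "char_poly (?B * ?C) =
      (\<Prod>a\<in>vecs (m + 1). [:- real (CARD('a) * card {x::'a. poly (JW_poly m a) x = 0}), 1:])"
    unfolding lmat_mult[OF ls(1)] unfolding ls(2) by (rule char_poly_common_points[OF m ls])
  finally show ?thesis
    by (simp add: pcompose_prod pcompose_pCons)
qed

section \<open>Counting polynomials by their number of roots\<close>

abbreviation roots :: "'a::comm_semiring_0 poly \<Rightarrow> 'a set" where
  "roots f \<equiv> {x. poly f x = 0}"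

definition monics :: "nat \<Rightarrow> 'a::comm_semiring_1 poly set" where
  "monics d = {f. degree f = d \<and> lead_coeff f = 1}"

lemma finite_degree_le: "finite {f :: 'a::{finite,zero} poly. degree f \<le> n}"
proof (induction n)
  case 0
  have "{f :: 'a poly. degree f \<le> 0} \<subseteq> range (\<lambda>c. [:c:])"
    by (auto elim!: degree_eq_zeroE)
  then show ?case
    by (rule finite_subset) simp
next
  case (Suc n)
  have "{f :: 'a poly. degree f \<le> Suc n} \<subseteq> (\<lambda>(a, g). pCons a g) ` (UNIV \<times> {g. degree g \<le> n})"
  proof
    fix f :: "'a poly"
    assume f: "f \<in> {f. degree f \<le> Suc n}"
    obtain a g where "f = pCons a g"
      by (rule pCons_cases)
    moreover from this f have "degree g \<le> n"
      by (auto split: if_splits)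
    ultimately show "f \<in> (\<lambda>(a, g). pCons a g) ` (UNIV \<times> {g. degree g \<le> n})"
      by auto
  qed
  then show ?case
    by (rule finite_subset) (use Suc in auto)
qed

lemma finite_monics [simp]: "finite (monics d :: 'a::{finite,field} poly set)"
  by (rule finite_subset[OF _ finite_degree_le[of d]]) (auto simp: monics_def)

lemma card_monics: "card (monics d :: 'a::{finite,field} poly set) = CARD('a) ^ d"
proof (induction d)
  case 0
  have "monics 0 = {1 :: 'a poly}"
    by (auto simp: monics_def elim!: degree_eq_zeroE)
  then show ?case
    by simp
next
  case (Suc d)
  have "bij_betw (\<lambda>(a, g). pCons a g) (UNIV \<times> monics d) (monics (Suc d) :: 'a poly set)"
    unfolding bij_betw_def
  proof
    show "inj_on (\<lambda>(a :: 'a, g). pCons a g) (UNIV \<times> monics d)"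
      by (auto simp: inj_on_def)
    show "(\<lambda>(a, g). pCons a g) ` (UNIV \<times> monics d) = (monics (Suc d) :: 'a poly set)"
    proof (intro equalityI subsetI)
      fix f :: "'a poly"
      assume f: "f \<in> monics (Suc d)"
      obtain a g where "f = pCons a g"
        by (rule pCons_cases)
      moreover from this f have "g \<in> monics d"
        by (auto simp: monics_def split: if_splits)
      ultimately show "f \<in> (\<lambda>(a, g). pCons a g) ` (UNIV \<times> monics d)"
        by auto
    qed (auto simp: monics_def)
  qed
  then have "card (monics (Suc d) :: 'a poly set) = card (UNIV \<times> (monics d :: 'a poly set) :: ('a \<times> _) set)"
    by (simp add: bij_betw_same_card)
  then show ?case
    using Suc by (simp add: card_cartesian_product)
qed

lemma monics_nonzero: "f \<in> monics d \<Longrightarrow> f \<noteq> (0 :: 'a::field poly)"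
  by (auto simp: monics_def)

lemma mult_mem_monics:
  "f \<in> monics d \<Longrightarrow> g \<in> monics e \<Longrightarrow> f * g \<in> monics (d + e)" for f g :: "'a::field poly"
  using monics_nonzero[of f d] monics_nonzero[of g e]
  by (auto simp: monics_def degree_mult_eq coeff_mult_degree_sum)

lemma prod_linear_mem_monics:
  "finite U \<Longrightarrow> (\<Prod>x\<in>U. [:- x, 1:]) \<in> (monics (card U) :: 'a::field poly set)"
proof (induction U rule: finite_induct)
  case (insert x U)
  have "[:- x, 1:] \<in> monics 1"
    by (simp add: monics_def)
  from mult_mem_monics[OF this insert.IH] insert.hyps show ?case
    by simp
qed (simp add: monics_def)

lemma prod_linear_dvd_iff:
  fixes f :: "'a::field poly"
  assumes "finite U"
  shows "(\<Prod>x\<in>U. [:- x, 1:]) dvd f \<longleftrightarrow> (\<forall>x\<in>U. poly f x = 0)"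
  using assms
proof (induction U arbitrary: f rule: finite_induct)
  case (insert x U)
  let ?w = "\<Prod>x\<in>U. [:- x, 1:]"
  have w: "poly ?w x \<noteq> 0"
    using insert.hyps by (simp add: poly_prod)
  have "[:- x, 1:] * ?w dvd f \<longleftrightarrow> ?w dvd f \<and> poly f x = 0"
  proof
    assume "[:- x, 1:] * ?w dvd f"
    then show "?w dvd f \<and> poly f x = 0"
      by (metis dvd_mult_left dvd_mult_right poly_eq_0_iff_dvd)
  next
    assume a: "?w dvd f \<and> poly f x = 0"
    then obtain g where g: "f = ?w * g"
      by blast
    with a w have "poly g x = 0"
      by simp
    then have "[:- x, 1:] dvd g"
      by (simp add: poly_eq_0_iff_dvd)
    then show "[:- x, 1:] * ?w dvd f"
      unfolding g by (metis mult.commute mult_dvd_mono dvd_refl)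
  qed
  then show ?case
    using insert by auto
qed auto

text \<open>Vanishing on \<open>U\<close> means divisibility by the product of the linear factors,
  and the cofactor is an arbitrary monic polynomial of degree \<open>d - card U\<close>.\<close>

lemma card_monics_vanishing:
  fixes U :: "'a::{finite,field} set"
  shows "card {f \<in> monics d. U \<subseteq> roots f} = (if card U \<le> d then CARD('a) ^ (d - card U) else 0)"
proof (cases "card U \<le> d")
  case True
  let ?w = "\<Prod>x\<in>U. [:- x, 1:]"
  have w: "?w \<in> monics (card U)"
    by (rule prod_linear_mem_monics) simp
  have "bij_betw ((*) ?w) (monics (d - card U)) {f \<in> monics d. U \<subseteq> roots f}"
    unfolding bij_betw_def
  proof
    show "inj_on ((*) ?w) (monics (d - card U))"
      using monics_nonzero[OF w] by (intro inj_onI) simp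
    show "(*) ?w ` monics (d - card U) = {f \<in> monics d. U \<subseteq> roots f}"
    proof (intro equalityI subsetI)
      fix f assume "f \<in> (*) ?w ` monics (d - card U)"
      then obtain g where g: "f = ?w * g" "g \<in> monics (d - card U)"
        by blast
      have "f \<in> monics d"
        using mult_mem_monics[OF w g(2)] True by (simp add: g(1))
      moreover have "?w dvd f"
        by (simp add: g(1))
      ultimately show "f \<in> {f \<in> monics d. U \<subseteq> roots f}"
        by (simp add: prod_linear_dvd_iff subset_iff)
    next
      fix f assume f: "f \<in> {f \<in> monics d. U \<subseteq> roots f}"
      then have "?w dvd f"
        by (subst prod_linear_dvd_iff) auto
      then obtain g where g: "f = ?w * g"
        by blast
      with f have "g \<noteq> 0"
        using monics_nonzero[of f d] by auto
      with f g w monics_nonzero[OF w] have "g \<in> monics (d - card U)"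
        by (auto simp: monics_def degree_mult_eq coeff_mult_degree_sum)
      with g show "f \<in> (*) ?w ` monics (d - card U)"
        by blast
    qed
  qed
  from bij_betw_same_card[OF this] True show ?thesis
    by (simp add: card_monics)
next
  case False
  have "{f \<in> monics d. U \<subseteq> roots f} = {}"
  proof (rule ccontr)
    assume "{f \<in> monics d. U \<subseteq> roots f} \<noteq> {}"
    then obtain f where f: "f \<in> monics d" "U \<subseteq> roots f"
      by auto
    have "card U \<le> card (roots f)"
      using f(2) by (intro card_mono) auto
    also have "\<dots> \<le> d"
      using poly_roots_degree[OF monics_nonzero[OF f(1)]] f(1) by (simp add: monics_def)
    finally show False
      using False by simp
  qed
  with False show ?thesis
    by simp
qed

section \<open>Inclusion-exclusion over prescribed root sets\<close>

lemma sum_Pow_alternating: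
  assumes "finite A"
  shows "(\<Sum>T\<in>Pow A. (-1) ^ card T) = (if A = {} then 1 else 0 :: int)"
proof (cases "A = {}")
  case False
  then have "{} \<subset> A"
    by auto
  from card_subsupersets_even_odd[OF assms this] have "(\<Sum>T\<in>Pow A. (-1) ^ card T) = (0::int)"
    using assms by (intro sum_alternating_cancels) simp_all
  with False show ?thesis
    by simp
qed simp

text \<open>An alternating sum over the sets \<open>T\<close> of roots outside \<open>S\<close>
  detects whether there are any. Exchanging the sums leaves counts of polynomials vanishing on
  \<open>S \<union> T\<close>, which depend only on the size of \<open>T\<close>.\<close>

lemma card_monics_root_set:
  fixes S :: "'a::{finite,field} set"
  assumes "card S \<le> d"
  shows "int (card {f \<in> monics d. roots f = S}) =
    (\<Sum>k=0..d - card S. (-1) ^ k * int ((CARD('a) - card S) choose k) * int CARD('a) ^ (d - card S - k))"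
proof -
  let ?q = "CARD('a)" and ?i = "card S"
  let ?M = "{f \<in> monics d. S \<subseteq> roots f}"
  \<comment> \<open>Without the guard, truncated subtraction would give q^0 = 1 instead of 0 for
    \<open>?i + k > d\<close>.\<close>
  let ?h = "\<lambda>k. (-1) ^ k * (if ?i + k \<le> d then int ?q ^ (d - (?i + k)) else 0)"
  have "int (card {f \<in> monics d. roots f = S}) = (\<Sum>f\<in>?M. if roots f - S = {} then 1 else 0)"
    by (subst sum.inter_filter[symmetric]) (auto intro!: arg_cong[of _ _ card])
  also have "\<dots> = (\<Sum>f\<in>?M. \<Sum>T\<in>Pow (- S). if T \<subseteq> roots f then (-1) ^ card T else 0)"
  proof (rule sum.cong[OF refl])
    fix f :: "'a poly"
    have "(\<Sum>T\<in>Pow (- S). if T \<subseteq> roots f then (-1) ^ card T else 0) =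
        (\<Sum>T\<in>Pow (roots f - S). (-1) ^ card T :: int)"
      by (subst sum.inter_filter[symmetric]) (auto intro!: sum.cong)
    then show "(if roots f - S = {} then 1 else 0) =
        (\<Sum>T\<in>Pow (- S). if T \<subseteq> roots f then (-1) ^ card T else 0 :: int)"
      by (simp only: sum_Pow_alternating[OF finite])
  qed
  also have "\<dots> = (\<Sum>T\<in>Pow (- S). \<Sum>f\<in>?M. if T \<subseteq> roots f then (-1) ^ card T else 0)"
    by (rule sum.swap)
  also have "\<dots> = (\<Sum>T\<in>Pow (- S). ?h (card T))"
  proof (rule sum.cong[OF refl])
    fix T assume "T \<in> Pow (- S)"
    then have card: "card (S \<union> T) = ?i + card T"
      by (intro card_Un_disjoint) auto
    have "(\<Sum>f\<in>?M. if T \<subseteq> roots f then (-1) ^ card T else 0 :: int) =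
        (-1) ^ card T * int (card {f \<in> monics d. S \<union> T \<subseteq> roots f})"
      by (subst sum.inter_filter[symmetric]) (auto intro!: arg_cong[of _ _ card])
    then show "(\<Sum>f\<in>?M. if T \<subseteq> roots f then (-1) ^ card T else 0) = ?h (card T)"
      unfolding card_monics_vanishing card by simp
  qed
  \<comment> \<open>The bound covers both the possible sizes of \<open>T\<close> and the final range
    up to \<open>d - ?i\<close>.\<close>
  also have "\<dots> = (\<Sum>k=0..max ?q d. \<Sum>T | T \<in> Pow (- S) \<and> card T = k. ?h (card T))"
  proof (rule sum.group[symmetric])
    have "card T \<le> max ?q d" for T :: "'a set"
      using card_mono[of UNIV T] by (simp add: le_max_iff_disj)
    then show "card ` Pow (- S) \<subseteq> {0..max ?q d}"
      by auto
  qed auto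
  also have "\<dots> = (\<Sum>k=0..max ?q d. int ((?q - ?i) choose k) * ?h k)"
    by (intro sum.cong) (simp_all add: n_subsets Compl_eq_Diff_UNIV card_Diff_subset)
  also have "\<dots> = (\<Sum>k=0..d - ?i. int ((?q - ?i) choose k) * ?h k)"
    using assms by (intro sum.mono_neutral_right) auto
  also have "\<dots> = (\<Sum>k=0..d - ?i. (-1) ^ k * int ((?q - ?i) choose k) * int ?q ^ (d - ?i - k))"
    using assms by (intro sum.cong) auto
  finally show ?thesis .
qed

lemma card_monics_card_roots:
  fixes i d :: nat
  assumes "i \<le> d"
  shows "int (card {f :: 'a::{finite,field} poly. f \<in> monics d \<and> card (roots f) = i}) =
    int (CARD('a) choose i) *
      (\<Sum>k=0..d - i. (-1) ^ k * int ((CARD('a) - i) choose k) * int CARD('a) ^ (d - i - k))"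
proof -
  let ?Q = "{S :: 'a set. S \<subseteq> UNIV \<and> card S = i}"
  have "{f :: 'a poly. f \<in> monics d \<and> card (roots f) = i} = (\<Union>S\<in>?Q. {f \<in> monics d. roots f = S})"
    by auto
  then have "card {f :: 'a poly. f \<in> monics d \<and> card (roots f) = i} =
      (\<Sum>S\<in>?Q. card {f \<in> monics d. roots f = S})"
    by (simp only:) (rule card_UN_disjoint, auto)
  then have "int (card {f :: 'a poly. f \<in> monics d \<and> card (roots f) = i}) =
      (\<Sum>S\<in>?Q. int (card {f \<in> monics d. roots f = S}))"
    by simp
  also have "\<dots> = (\<Sum>S\<in>?Q.
      \<Sum>k=0..d - i. (-1) ^ k * int ((CARD('a) - i) choose k) * int CARD('a) ^ (d - i - k))"
    using assms by (intro sum.cong refl) (simp add: card_monics_root_set)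
  also have "\<dots> = int (card ?Q) *
      (\<Sum>k=0..d - i. (-1) ^ k * int ((CARD('a) - i) choose k) * int CARD('a) ^ (d - i - k))"
    by simp
  also have "card ?Q = CARD('a) choose i"
    by (rule n_subsets) simp
  finally show ?thesis .
qed

text \<open>Dividing by the leading coefficient keeps the roots.\<close>

lemma card_degree_card_roots:
  "card {f :: 'a::{finite,field} poly. f \<noteq> 0 \<and> degree f = d \<and> card (roots f) = i} =
    (CARD('a) - 1) * card {f :: 'a poly. f \<in> monics d \<and> card (roots f) = i}"
proof -
  have "bij_betw (\<lambda>(c, f). Polynomial.smult c f)
      ((- {0}) \<times> {f :: 'a poly. f \<in> monics d \<and> card (roots f) = i})
      {f. f \<noteq> 0 \<and> degree f = d \<and> card (roots f) = i}"
    by (rule bij_betwI[where g = "\<lambda>f. (lead_coeff f, Polynomial.smult (inverse (lead_coeff f)) f)"])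
      (auto simp: monics_def)
  from bij_betw_same_card[OF this] show ?thesis
    by (simp add: card_cartesian_product Compl_eq_Diff_UNIV card_Diff_subset)
qed

lemma card_degree_less_card_roots:
  fixes i m :: nat
  assumes "1 \<le> m"
  shows "int (card {f :: 'a::{finite,field} poly. f \<noteq> 0 \<and> degree f < m \<and> card (roots f) = i}) =
    (int CARD('a) - 1) * int (CARD('a) choose i) *
      (\<Sum>d=i..m - 1. \<Sum>k=0..d - i.
        (-1) ^ k * int ((CARD('a) - i) choose k) * int CARD('a) ^ (d - i - k))"
proof -
  let ?F = "\<lambda>d. {f :: 'a poly. f \<noteq> 0 \<and> degree f = d \<and> card (roots f) = i}"
  have q: "int (CARD('a) - 1) = int CARD('a) - 1"
    by (simp add: of_nat_diff Suc_leI)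
  have fin: "finite (?F d)" for d
    by (rule finite_subset[OF _ finite_degree_le[of d]]) auto
  have "{f :: 'a poly. f \<noteq> 0 \<and> degree f < m \<and> card (roots f) = i} = (\<Union>d\<in>{..<m}. ?F d)"
    by auto
  then have "card {f :: 'a poly. f \<noteq> 0 \<and> degree f < m \<and> card (roots f) = i} = (\<Sum>d<m. card (?F d))"
    by (simp only:) (rule card_UN_disjoint, use fin in auto)
  \<comment> \<open>A nonzero polynomial of degree below \<open>i\<close> has fewer than
    \<open>i\<close> roots.\<close>
  also have "\<dots> = (\<Sum>d=i..m - 1. card (?F d))"
  proof (rule sum.mono_neutral_right)
    show "\<forall>d\<in>{..<m} - {i..m - 1}. card (?F d) = 0"
    proof
      fix d assume "d \<in> {..<m} - {i..m - 1}"
      then have "d < i"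
        by auto
      then have "?F d = {}"
        using poly_roots_degree by fastforce
      then show "card (?F d) = 0"
        by (simp only: card.empty)
    qed
  qed (use assms in auto)
  finally have "int (card {f :: 'a poly. f \<noteq> 0 \<and> degree f < m \<and> card (roots f) = i}) =
      (\<Sum>d=i..m - 1. int (card (?F d)))"
    by simp
  also have "\<dots> = (\<Sum>d=i..m - 1. (int CARD('a) - 1) * (int (CARD('a) choose i) *
      (\<Sum>k=0..d - i. (-1) ^ k * int ((CARD('a) - i) choose k) * int CARD('a) ^ (d - i - k))))"
    by (intro sum.cong refl)
      (simp only: card_degree_card_roots of_nat_mult q card_monics_card_roots atLeastAtMost_iff)
  finally show ?thesis
    by (simp only: sum_distrib_left mult.assoc)
qed

text \<open>After scaling, the polynomial is x^(m+1) + v, and the vanishing coefficient of x^m is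
  what bounds the degree of v by \<open>m - 1\<close>.\<close>

lemma card_degree_eq_card_roots:
  assumes "1 \<le> m"
  shows "card {f :: 'a::{finite,field} poly. degree f = m + 1 \<and> coeff f m = 0 \<and> card (roots f) = i} =
    (CARD('a) - 1) * root_count_num i (monom (1::'a) (m + 1)) (m - 1)"
proof -
  let ?X = "monom (1::'a) (m + 1)"
  have deg: "degree (?X + v) = m + 1" "coeff (?X + v) (m + 1) = 1" "coeff (?X + v) m = 0"
    if "degree v \<le> m - 1" for v
    using that assms by (auto simp: degree_add_eq_left degree_monom_eq coeff_eq_0)
  have lc: "coeff f (Suc m) \<noteq> 0" if "degree f = m + 1" for f :: "'a poly"
    using that leading_coeff_0_iff[of f] by auto
  have "bij_betw (\<lambda>(c, v). Polynomial.smult c (?X + v))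
      ((- {0}) \<times> {v. degree v \<le> m - 1 \<and> card (roots (?X + v)) = i})
      {f. degree f = m + 1 \<and> coeff f m = 0 \<and> card (roots f) = i}"
  proof (rule bij_betwI[where g = "\<lambda>f. (lead_coeff f, Polynomial.smult (inverse (lead_coeff f)) f - ?X)"], goal_cases)
    case 1
    show ?case
      using deg by (auto simp del: poly_add)
  next
    case 2
    have "degree (Polynomial.smult (inverse (lead_coeff f)) f - ?X) \<le> m - 1"
      if f: "degree f = m + 1" "coeff f m = 0" for f
    proof (rule degree_le, intro allI impI)
      fix n assume "m - 1 < n"
      then consider "n = m" | "n = m + 1" | "n > m + 1"
        using assms by linarith
      then show "coeff (Polynomial.smult (inverse (lead_coeff f)) f - ?X) n = 0"
        using f lc[OF f(1)] by cases (auto simp: coeff_eq_0)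
    qed
    then show ?case
      using lc by auto
  next
    case (3 x)
    then show ?case
      using deg by auto
  next
    case (4 f)
    then show ?case
      using lc by auto
  qed
  from bij_betw_same_card[OF this] show ?thesis
    by (simp add: root_count_num_def card_cartesian_product Compl_eq_Diff_UNIV card_Diff_subset)
qed

section \<open>The polynomials attached to the characters\<close>

lemma coeff_JW_poly:
  assumes "1 \<le> m"
  shows "coeff (JW_poly m a) n = (if n < m then a (n + 1) else if n = m + 1 then a n else 0)"
proof -
  have "coeff (JW_poly m a) n = (\<Sum>k=1..m + 1. if k = JW_exp m k + (if n = m + 1 then 0 else 1) \<and> JW_exp m k = n then a k else 0)"
    unfolding JW_poly_def coeff_sum coeff_monom by (rule sum.cong) (auto simp: JW_exp_def)
  \<comment> \<open>The default 0 lies outside \<open>{1..m + 1}\<close>: no coordinate has exponent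
    m or an exponent above m + 1.\<close>
  also have "\<dots> = (\<Sum>k=1..m + 1. if k = (if n < m then n + 1 else if n = m + 1 then n else 0) then a k else 0)"
    by (rule sum.cong) (auto simp: JW_exp_def)
  also have "\<dots> = (if n < m then a (n + 1) else if n = m + 1 then a n else 0)"
    by (subst sum.delta) auto
  finally show ?thesis .
qed

lemma bij_betw_JW_poly:
  assumes "1 \<le> m"
  shows "bij_betw (JW_poly m) (vecs (m + 1)) {f :: 'a::field poly. degree f \<le> m + 1 \<and> coeff f m = 0}"
proof (rule bij_betwI[where g = "\<lambda>f. \<lambda>k\<in>{1..m + 1}. coeff f (JW_exp m k)"], goal_cases)
  case 1
  show ?case
    using assms by (auto simp: coeff_JW_poly intro!: degree_le)
next
  case 2
  show ?case
    by (auto simp: vecs_def)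
next
  case (3 a)
  then show ?case
    using assms by (auto simp: coeff_JW_poly JW_exp_def vecs_def fun_eq_iff PiE_iff extensional_def)
next
  case (4 f)
  then have "coeff f n = 0" if "\<not> n < m" "n \<noteq> m + 1" for n
    using that by (cases "n = m") (auto simp: coeff_eq_0)
  then show ?case
    using assms by (auto simp: coeff_JW_poly JW_exp_def poly_eq_iff)
qed

text \<open>As \<open>i \<noteq> CARD('a)\<close>, the zero polynomial is not counted. A nonzero
  polynomial without x^m term cannot have degree m, so its degree is below m or equal to m + 1,
  which gives the two summands.\<close>

lemma card_JW_poly_card_roots:
  fixes i m :: nat
  assumes m: "1 \<le> m" and i: "i \<noteq> CARD('a)"
  shows "int (card {a \<in> vecs (m + 1). card (roots (JW_poly m a :: 'a::{finite,field} poly)) = i}) =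
    (int CARD('a) - 1) * int (CARD('a) choose i) *
      (\<Sum>d=i..m - 1. \<Sum>k=0..d - i.
        (-1) ^ k * int ((CARD('a) - i) choose k) * int CARD('a) ^ (d - i - k))
    + (int CARD('a) - 1) * int (root_count_num i (monom (1::'a) (m + 1)) (m - 1))"
proof -
  let ?V = "{a \<in> vecs (m + 1). card (roots (JW_poly m a :: 'a poly)) = i}"
  let ?A = "{f :: 'a poly. f \<noteq> 0 \<and> degree f < m \<and> card (roots f) = i}"
  let ?B = "{f :: 'a poly. degree f = m + 1 \<and> coeff f m = 0 \<and> card (roots f) = i}"
  have bij: "bij_betw (JW_poly m) (vecs (m + 1)) {f :: 'a poly. degree f \<le> m + 1 \<and> coeff f m = 0}"
    by (rule bij_betw_JW_poly[OF m])
  have "JW_poly m ` ?V = {f \<in> JW_poly m ` vecs (m + 1). card (roots f) = i}"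
    by auto
  also have "\<dots> = {f :: 'a poly. degree f \<le> m + 1 \<and> coeff f m = 0 \<and> card (roots f) = i}"
    by (simp only: bij_betw_imp_surj_on[OF bij] mem_Collect_eq conj_assoc)
  also have "\<dots> = ?A \<union> ?B"
  proof (intro equalityI subsetI)
    fix f :: "'a poly"
    assume "f \<in> {f. degree f \<le> m + 1 \<and> coeff f m = 0 \<and> card (roots f) = i}"
    then have f: "degree f \<le> m + 1" "coeff f m = 0" "card (roots f) = i"
      by auto
    have "f \<noteq> 0"
      using f(3) i by auto
    with f(2) have "degree f \<noteq> m"
      by auto
    with f \<open>f \<noteq> 0\<close> show "f \<in> ?A \<union> ?B"
      by auto
  qed (auto simp: coeff_eq_0)
  finally have "card ?V = card (?A \<union> ?B)"
    using card_image[OF inj_on_subset[OF bij_betw_imp_inj_on[OF bij]], of ?V] by auto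
  also have "\<dots> = card ?A + card ?B"
    by (rule card_Un_disjoint)
      (auto intro: finite_subset[OF _ finite_degree_le[of "m + 1"]])
  finally have "card ?V = card ?A + card ?B" .
  moreover have "int (CARD('a) - 1) = int CARD('a) - 1"
    by (simp add: Suc_leI)
  ultimately show ?thesis
    by (simp only: of_nat_add of_nat_mult card_degree_less_card_roots[OF m] card_degree_eq_card_roots[OF m])
qed

section \<open>Zero-sum subsets of a finite field\<close>

text \<open>Translation by 1 permutes the field; comparing the sums of all elements gives q * 1 = 0,
  so the characteristic, which is \<open>p\<close>, divides q.\<close>

lemma prime_dvd_card:
  assumes "prime p" "of_nat p = (0 :: 'a::{finite,field})"
  shows "p dvd CARD('a)"
proof -
  have "(\<Sum>x\<in>UNIV. x) = (\<Sum>x\<in>UNIV. x + 1 :: 'a)"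
    by (rule sum.reindex_bij_witness[of _ "\<lambda>x. x + 1" "\<lambda>x. x - 1"]) auto
  then have "of_nat CARD('a) = (0 :: 'a)"
    by (simp add: sum.distrib)
  then have "CHAR('a) dvd CARD('a)"
    by (simp add: of_nat_eq_0_iff_char_dvd)
  moreover have "CHAR('a) dvd p"
    using assms(2) by (simp add: of_nat_eq_0_iff_char_dvd)
  then have "CHAR('a) = p"
    using assms(1) prime_nat_iff[of p] by auto
  ultimately show ?thesis
    by simp
qed

text \<open>The set is a union of \<open>j\<close> pairs \<open>{x, f x}\<close>, each with sum
  \<open>d\<close>. In characteristic 2, \<open>f\<close> will be translation by 1 with d = 1,
  otherwise negation with d = 0.\<close>

lemma ex_invariant_subset:
  fixes f :: "'a \<Rightarrow> 'a::comm_ring_1"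
  assumes "finite T" "\<And>x. x \<in> T \<Longrightarrow> f x \<in> T" "\<And>x. x \<in> T \<Longrightarrow> f (f x) = x" "\<And>x. x \<in> T \<Longrightarrow> f x \<noteq> x"
    and "\<And>x. x \<in> T \<Longrightarrow> x + f x = d" and "2 * j \<le> card T"
  shows "\<exists>S\<subseteq>T. card S = 2 * j \<and> \<Sum>S = of_nat j * d"
  using assms
proof (induction j arbitrary: T)
  case 0
  then show ?case
    by (intro exI[of _ "{}"]) simp
next
  case (Suc j)
  then obtain x where x: "x \<in> T"
    by fastforce
  note fx = Suc.prems(2,3,4,5)[OF x]
  let ?T = "T - {x, f x}"
  have "card ?T = card T - 2"
    using x fx Suc.prems(1) by (simp add: card_Diff_subset)
  moreover have "f y \<in> ?T" if "y \<in> ?T" for y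
    using that Suc.prems(2,3)[of y] fx by auto
  ultimately have "\<exists>S\<subseteq>?T. card S = 2 * j \<and> \<Sum>S = of_nat j * d"
    using Suc.prems by (intro Suc.IH) auto
  then obtain S where S: "S \<subseteq> ?T" "card S = 2 * j" "\<Sum>S = of_nat j * d"
    by blast
  have fin: "finite S"
    using S(1) Suc.prems(1) by (meson finite_Diff finite_subset)
  have "x \<notin> S" "f x \<notin> S"
    using S(1) by auto
  then have "card (insert x (insert (f x) S)) = 2 * Suc j"
    using S(2) fx fin by simp
  moreover have "\<Sum>(insert x (insert (f x) S)) = (x + f x) + \<Sum>S"
    using \<open>x \<notin> S\<close> \<open>f x \<notin> S\<close> fx fin by (simp add: add.assoc)
  then have "\<Sum>(insert x (insert (f x) S)) = of_nat (Suc j) * d"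
    using fx S(3) by (simp add: algebra_simps)
  moreover have "insert x (insert (f x) S) \<subseteq> T"
    using S(1) x fx by auto
  ultimately show ?case
    by (intro exI[of _ "insert x (insert (f x) S)"]) simp
qed

lemma even_card_involution:
  assumes "finite T" "\<And>x. x \<in> T \<Longrightarrow> f x \<in> T" "\<And>x. x \<in> T \<Longrightarrow> f (f x) = x" "\<And>x. x \<in> T \<Longrightarrow> f x \<noteq> x"
  shows "even (card T)"
  using assms
proof (induction "card T" arbitrary: T rule: less_induct)
  case less
  show ?case
  proof (cases "T = {}")
    case False
    then obtain x where x: "x \<in> T"
      by auto
    note fx = less.prems(2,3,4)[OF x]
    let ?T = "T - {x, f x}"
    have card: "card T = card ?T + 2"
      using x fx less.prems(1) card_mono[of T "{x, f x}"] by (simp add: card_Diff_subset)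
    have "f y \<in> ?T" if "y \<in> ?T" for y
      using that less.prems(2,3)[of y] fx by auto
    then have "even (card ?T)"
      using less.prems card by (intro less.hyps) auto
    then show ?thesis
      by (simp add: card)
  qed simp
qed

lemma ex_not_in_list: "length xs < CARD('a) \<Longrightarrow> \<exists>z::'a::finite. z \<notin> set xs"
  by (metis UNIV_I card_length card_mono finite_set leD le_trans subsetI)

section \<open>Zero-sum sets in characteristic 2\<close>

lemma char2_simps:
  assumes "(1 :: 'a::comm_ring_1) + 1 = 0"
  shows "a + a = (0::'a)" "a + (a + b) = (b::'a)"
proof -
  have "a + a = a * (1 + 1)"
    by (simp only: distrib_left mult_1_right)
  then show aa: "a + a = 0"
    using assms by simp
  show "a + (a + b) = b"
    by (simp add: add.assoc[symmetric] aa)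
qed

text \<open>Equality means sum 0 in characteristic 2, so summands may be moved across an inequality
  freely.\<close>

lemma char2_neqI:
  assumes "(1 :: 'a::comm_ring_1) + 1 = 0" "u' \<noteq> (v'::'a)" "u + v = u' + v'"
  shows "u \<noteq> v"
  using assms by (metis add.commute add_left_cancel char2_simps)

text \<open>Since \<open>W\<close> is closed under \<open>x \<mapsto> x + 1\<close>, the set \<open>Q\<close> can be enlarged by pairs \<open>{z, z + 1}\<close> outside of
  \<open>W\<close>; an even number of them does not change the sum.\<close>

lemma char2_ex_zero_sum_six:
  assumes char: "(1 :: 'a::{finite,field}) + 1 = 0" and q: "CARD('a) \<ge> 10"
  shows "\<exists>Q W. Q \<subseteq> W \<and> card Q = 6 \<and> \<Sum>Q = (0::'a) \<and> card W \<le> 10 \<and> (\<forall>x\<in>W. x + 1 \<in> W)"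
proof -
  note [simp] = char2_simps[OF char]
  obtain c :: 'a where c: "c \<notin> set [0, 1]"
    using ex_not_in_list[of "[0, 1::'a]"] q by auto
  obtain x :: 'a where x: "x \<notin> set [0, 1, c, c + 1]"
    using ex_not_in_list[of "[0, 1, c, c + 1]"] q by auto
  obtain y :: 'a where y: "y \<notin> set [0, 1, c, c + 1, x, x + 1, x + c, x + c + 1]"
    using ex_not_in_list[of "[0, 1, c, c + 1, x, x + 1, x + c, x + c + 1]"] q by auto
  \<comment> \<open>Three pairs with differences 1, \<open>c\<close> and \<open>c + 1\<close>, which
    cancel. Each of \<open>c\<close>, \<open>x\<close>, \<open>y\<close> avoids the additive span of
    1 and the earlier choices, hence distinctness; \<open>?ws\<close> adds the translates by
    1.\<close>
  let ?Q = "{0, 1, x, x + c, y, y + 1 + c}"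
  let ?ws = "[0, 1, x, x + 1, x + c, x + c + 1, y, y + 1, y + c, y + 1 + c]"
  note neqI = char2_neqI[OF char]
  have n1: "x + c \<noteq> 0" by (rule neqI[of x c]) (use x in \<open>auto simp: ac_simps\<close>)
  have n2: "x + c \<noteq> 1" by (rule neqI[of x "c + 1"]) (use x in \<open>auto simp: ac_simps\<close>)
  have n3: "y + 1 + c \<noteq> 0" by (rule neqI[of y "c + 1"]) (use y in \<open>auto simp: ac_simps\<close>)
  have n4: "y + 1 + c \<noteq> 1" by (rule neqI[of y c]) (use y in \<open>auto simp: ac_simps\<close>)
  have n5: "y + 1 + c \<noteq> x" by (rule neqI[of y "x + c + 1"]) (use y in \<open>auto simp: ac_simps\<close>)
  have n6: "y + 1 + c \<noteq> x + c" by (rule neqI[of y "x + 1"]) (use y in \<open>auto simp: ac_simps\<close>)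
  have n7: "y + 1 + c \<noteq> y" by (rule neqI[of c 1]) (use c in \<open>auto simp: ac_simps\<close>)
  have distinct: "distinct [0, 1, x, x + c, y, y + 1 + c]"
    using c x y n1 n2 n3 n4 n5 n6 n7 by (auto simp del: add_cancel_left_right)
  have "card ?Q = 6"
    using distinct_card[OF distinct] by simp
  moreover have "\<Sum>?Q = sum_list [0, 1, x, x + c, y, y + 1 + c]"
    using sum_list_distinct_conv_sum_set[OF distinct, of "\<lambda>x. x"] by simp
  then have "\<Sum>?Q = 0"
    by (simp add: ac_simps)
  moreover have "card (set ?ws) \<le> 10"
    using card_length[of ?ws] by simp
  moreover have "\<forall>z\<in>set ?ws. z + 1 \<in> set ?ws"
    by (simp add: ac_simps)
  moreover have "?Q \<subseteq> set ?ws"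
    by auto
  ultimately show ?thesis
    by blast
qed

text \<open>For sizes divisible by 4, an even number of pairs \<open>{x, x + 1}\<close> has sum 0.
  For sizes 2 modulo 4 the number of pairs would be odd and the sum 1, so six elements with sum 0
  replace three of the pairs.\<close>

lemma char2_ex_zero_sum_subset:
  assumes char: "(1 :: 'a::{finite,field}) + 1 = 0"
    and k: "k < CARD('a)" "k \<noteq> 2" "k \<noteq> CARD('a) - 2"
  shows "\<exists>S :: 'a set. card S = k \<and> \<Sum>S = 0"
proof (cases "odd k")
  case True
  then obtain l where l: "k = 2 * l + 1"
    by (elim oddE)
  obtain S :: "'a set" where S: "card S = k"
    using obtain_subset_with_card_n[of k "UNIV :: 'a set"] k by auto
  \<comment> \<open>As \<open>k\<close> is odd, the translation adds \<open>\<Sum>S\<close> once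
    more to the sum, which makes it 0.\<close>
  let ?S = "(\<lambda>x. x + \<Sum>S) ` S"
  have "of_nat k = (1::'a)"
    using char unfolding l by simp
  then have "\<Sum>?S = 0"
    by (subst sum.reindex) (auto simp: sum.distrib S char2_simps[OF char])
  moreover have "card ?S = k"
    using S by (subst card_image) auto
  ultimately show ?thesis
    by blast
next
  case False
  have two: "(2::'a) = 0"
    using char by simp
  have evenq: "even CARD('a)"
    using prime_dvd_card[of 2, where 'a = 'a] two by simp
  have inv: "\<exists>S\<subseteq>T. card S = 2 * j \<and> \<Sum>S = of_nat j * (1::'a)"
    if "\<And>x. x \<in> T \<Longrightarrow> x + 1 \<in> T" "2 * j \<le> card T" for T and j :: nat
    using that char2_simps[OF char] by (intro ex_invariant_subset[where f = "\<lambda>x. x + 1"]) (auto simp: ac_simps)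
  consider l where "k = 2 * (2 * l)" | l where "k = 2 * (2 * l + 1)"
    using False by (metis evenE oddE)
  then show ?thesis
  proof cases
    case 1
    then obtain S :: "'a set" where "card S = k" "\<Sum>S = of_nat (2 * l) * 1"
      using inv[of UNIV "2 * l"] k by auto
    then show ?thesis
      using two by auto
  next
    case 2
    \<comment> \<open>The second bound leaves \<open>k - 6\<close> elements outside the at most ten
      of \<open>W\<close>.\<close>
    have "6 \<le> k \<and> k + 4 \<le> q" if "even q" "k < q" "k \<noteq> q - 2" for q
      using that k(2) 2 by presburger
    then have k6: "6 \<le> k" "k + 4 \<le> CARD('a)"
      using evenq k by auto
    then obtain Q W where Q: "Q \<subseteq> W" "card Q = 6" "\<Sum>Q = (0::'a)" "card W \<le> 10" and W: "\<And>x. x \<in> W \<Longrightarrow> x + 1 \<in> W"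
      using char2_ex_zero_sum_six[OF char] by auto
    have "x + 1 \<in> - W" if "x \<in> - W" for x
      using that W[of "x + 1"] char by (auto simp: add.assoc)
    moreover have "2 * (2 * (l - 1)) \<le> card (- W)"
      using Q(4) k6 2 by (simp add: Compl_eq_Diff_UNIV card_Diff_subset)
    ultimately obtain S where S: "S \<subseteq> - W" "card S = 2 * (2 * (l - 1))" "\<Sum>S = of_nat (2 * (l - 1)) * (1::'a)"
      using inv by blast
    have disj: "Q \<inter> S = {}"
      using Q(1) S(1) by blast
    have "card (Q \<union> S) = k"
      using k6 2 by (subst card_Un_disjoint) (auto simp: disj Q S)
    moreover have "\<Sum>(Q \<union> S) = 0"
      by (subst sum.union_disjoint) (auto simp: disj Q S two)
    ultimately show ?thesis
      by blast
  qed
qed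

section \<open>Zero-sum sets in odd characteristic\<close>

lemma odd_card_field:
  assumes "(1 :: 'a::{finite,field}) + 1 \<noteq> 0"
  shows "odd CARD('a)" "\<And>x::'a. x \<noteq> 0 \<Longrightarrow> - x \<noteq> x"
proof -
  show neg: "- x \<noteq> x" if "x \<noteq> 0" for x :: 'a
  proof
    assume "- x = x"
    then have "x * (1 + 1) = 0"
      by (simp only: distrib_left mult_1_right) (metis add.left_inverse)
    with assms that show False
      by (metis mult_eq_0_iff)
  qed
  have "even (card (UNIV - {0::'a}))"
    by (rule even_card_involution[where f = uminus]) (use neg in auto)
  then show "odd CARD('a)"
    by (simp add: card_Diff_subset even_diff_nat)
qed

text \<open>Pairs \<open>{x, - x}\<close> are taken outside a symmetric set containing 0, the fixed
  point of negation. A list describes it, so that \<open>n\<close> bounds its size even when entries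
  coincide.\<close>

lemma odd_ex_symmetric_subset:
  assumes char: "(1 :: 'a::{finite,field}) + 1 \<noteq> 0"
    and X: "length xs \<le> n" "0 \<in> set xs" "\<And>x. x \<in> set xs \<Longrightarrow> - x \<in> set xs"
    and k: "even k" "k + n \<le> CARD('a)"
  shows "\<exists>S. S \<inter> set xs = {} \<and> card S = k \<and> \<Sum>S = (0::'a)"
proof -
  obtain j where j: "k = 2 * j"
    using k(1) by (elim evenE)
  have "card (set xs) \<le> n"
    using card_length[of xs] X(1) by simp
  then have "2 * j \<le> card (- set xs)"
    using k j by (simp add: Compl_eq_Diff_UNIV card_Diff_subset)
  moreover have "- x \<in> - set xs" "- x \<noteq> x" if "x \<in> - set xs" for x
    using that X(2) X(3)[of "- x"] odd_card_field(2)[OF char, of x] by auto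
  ultimately have "\<exists>S\<subseteq>- set xs. card S = 2 * j \<and> \<Sum>S = of_nat j * 0"
    by (intro ex_invariant_subset[where f = uminus]) (simp_all only: finite minus_minus add.right_inverse not_False_eq_True)
  then show ?thesis
    using j by auto
qed

lemma ex_zero_sum_subset:
  assumes k: "2 \<le> k" "k < CARD('a::{finite,field})"
    and ex: "even CARD('a) \<Longrightarrow> k \<noteq> 2 \<and> k \<noteq> CARD('a) - 2"
  shows "\<exists>S :: 'a set. card S = k \<and> \<Sum>S = 0"
proof (cases "(1 :: 'a) + 1 = 0")
  case True
  then have "even CARD('a)"
    using prime_dvd_card[of 2, where 'a = 'a] by simp
  with char2_ex_zero_sum_subset[OF True k(2)] ex show ?thesis
    by blast
next
  case False
  show ?thesis
  proof (cases "even k")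
    case True
    then show ?thesis
      using odd_ex_symmetric_subset[OF False, of "[0]" 1 k] k by auto
  next
    case odd: False
    then obtain S where "S \<inter> {0::'a} = {}" "card S = k - 1" "\<Sum>S = 0"
      using odd_ex_symmetric_subset[OF False, of "[0]" 1 "k - 1"] k by auto
    then show ?thesis
      using k by (intro exI[of _ "insert 0 S"]) simp
  qed
qed

text \<open>Here \<open>y\<close> is the doubled root. In characteristic 2 it cancels, so a zero-sum
  set of size \<open>m - 1\<close> is extended by any further element. In odd characteristic with
  odd \<open>m\<close>, the root 0 is doubled and the others form pairs
  \<open>{x, - x}\<close>.\<close>

lemma ex_zero_sum_subset_double:
  assumes m: "1 \<le> m" "m + 2 \<le> CARD('a::{finite,field})"
    and ex: "even CARD('a) \<Longrightarrow> m \<noteq> 3" "3 dvd CARD('a) \<Longrightarrow> m \<noteq> 2"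
  shows "\<exists>S (y::'a). card S = m \<and> y \<in> S \<and> y + \<Sum>S = 0"
proof (cases "(1 :: 'a) + 1 = 0")
  case True
  then have "even CARD('a)"
    using prime_dvd_card[of 2, where 'a = 'a] by simp
  with ex m have "m - 1 < CARD('a)" "m - 1 \<noteq> 2" "m - 1 \<noteq> CARD('a) - 2"
    by auto
  from char2_ex_zero_sum_subset[OF True this] obtain T where T: "card T = m - 1" "\<Sum>T = (0::'a)"
    by blast
  have "T \<noteq> UNIV"
    using T(1) m by auto
  then obtain y where "y \<notin> T"
    by blast
  with T m show ?thesis
    by (intro exI[of _ "insert y T"] exI[of _ y]) (simp add: char2_simps[OF True])
next
  case char: False
  note neg = odd_card_field(2)[OF char]
  show ?thesis
  proof (cases "odd m")
    case True
    then obtain S where "S \<inter> {0::'a} = {}" "card S = m - 1" "\<Sum>S = 0"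
      using odd_ex_symmetric_subset[OF char, of "[0]" 1 "m - 1"] m by auto
    then show ?thesis
      using m by (intro exI[of _ "insert 0 S"] exI[of _ 0]) simp
  next
    case False
    \<comment> \<open>Parity improves the bound to m + 3, the room needed below: (m - 2) + 5 and (m
      - 4) + 7.\<close>
    have "2 \<le> m \<and> m + 3 \<le> q" if "odd q" "m + 2 \<le> q" for q
      using that False m(1) by presburger
    then have m3: "2 \<le> m" "m + 3 \<le> CARD('a)"
      using odd_card_field(1)[OF char] m by auto
    show ?thesis
    proof (cases "(1 :: 'a) + 1 + 1 = 0")
      case False
      \<comment> \<open>The root 1 is doubled and -2 is simple; they differ because 3 is nonzero.
        The other roots are pairs outside the symmetric list.\<close>
      let ?xs = "[0, 1, - 1, 1 + 1, - (1 + 1)] :: 'a list"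
      have sym: "\<forall>x\<in>set ?xs. - x \<in> set ?xs"
        by (simp only: list.set ball_simps insert_iff minus_minus minus_zero simp_thms)
      have "\<exists>S. S \<inter> set ?xs = {} \<and> card S = m - 2 \<and> \<Sum>S = (0::'a)"
      proof (rule odd_ex_symmetric_subset[OF char, where n = 5])
        show "even (m - 2)" "m - 2 + 5 \<le> CARD('a)"
          using m3 \<open>\<not> odd m\<close> by auto
      qed (simp, simp, use sym in blast)
      then obtain S where S: "S \<inter> set ?xs = {}" "card S = m - 2" "\<Sum>S = (0::'a)"
        by blast
      have "(1::'a) \<noteq> - (1 + 1)"
        using False by (metis add.assoc add.right_inverse)
      then have "card (insert 1 (insert (- (1 + 1)) S)) = m" "\<Sum>(insert 1 (insert (- (1 + 1)) S)) = -1"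
        using S m3 by auto
      then show ?thesis
        by (intro exI[of _ "insert 1 (insert (- (1 + 1)) S)"] exI[of _ 1]) simp
    next
      case True
      then have "3 dvd CARD('a)"
        using prime_dvd_card[of 3, where 'a = 'a] by simp
      with ex \<open>\<not> odd m\<close> m3 have m4: "4 \<le> m"
        by (auto elim!: evenE)
      \<comment> \<open>Now -2 = 1, so 0 is doubled instead and joined by 1, 1 + b and 1 - b, whose
        sum is 3 = 0; \<open>b\<close> outside the prime field makes them distinct.\<close>
      obtain b :: 'a where b: "b \<notin> set [0, 1, - 1]"
        using ex_not_in_list[of "[0, 1, - 1 :: 'a]"] m3 m4 by auto
      let ?xs = "[0, 1, - 1, 1 + b, - (1 + b), 1 - b, - (1 - b)]"
      have sym: "\<forall>x\<in>set ?xs. - x \<in> set ?xs"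
        by (simp only: list.set ball_simps insert_iff minus_minus minus_zero simp_thms)
      have "\<exists>S. S \<inter> set ?xs = {} \<and> card S = m - 4 \<and> \<Sum>S = (0::'a)"
      proof (rule odd_ex_symmetric_subset[OF char, where n = 7])
        show "even (m - 4)" "m - 4 + 7 \<le> CARD('a)"
          using m3 m4 \<open>\<not> odd m\<close> by auto
      qed (simp, simp, use sym in blast)
      then obtain S where S: "S \<inter> set ?xs = {}" "card S = m - 4" "\<Sum>S = (0::'a)"
        by blast
      let ?ys = "[0, 1, 1 + b, 1 - b]"
      have "1 + b \<noteq> 0" "1 - b \<noteq> 0" "1 + b \<noteq> 1 - b"
        using b neg[of b] by (auto simp: add_eq_0_iff)
      then have ys: "distinct ?ys"
        using b by auto
      have "set ?ys \<subseteq> set ?xs"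
        by simp
      with S(1) have disj: "set ?ys \<inter> S = {}"
        by blast
      have "card (set ?ys \<union> S) = card (set ?ys) + card S" "\<Sum>(set ?ys \<union> S) = \<Sum>(set ?ys) + \<Sum>S"
        by (rule card_Un_disjoint[OF _ _ disj] sum.union_disjoint[OF _ _ disj]; rule finite)+
      moreover have "card (set ?ys) = 4"
        using distinct_card[OF ys] by simp
      moreover have "\<Sum>(set ?ys) = 0"
        using sum_list_distinct_conv_sum_set[OF ys, of "\<lambda>x. x"] True by (simp add: algebra_simps)
      ultimately show ?thesis
        using S m4 by (intro exI[of _ "set ?ys \<union> S"] exI[of _ 0]) auto
    qed
  qed
qed

text \<open>Lists allow a doubled root; the second claim is Vieta's formula for the coefficient
  below the leading one.\<close>

lemma prod_list_linear:
  fixes xs :: "'a::field list"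
  shows "(\<Prod>x\<leftarrow>xs. [:- x, 1:]) \<in> monics (length xs)" (is ?monic)
    and "length xs = Suc n \<Longrightarrow> coeff (\<Prod>x\<leftarrow>xs. [:- x, 1:]) n = - sum_list xs"
    and "roots (\<Prod>x\<leftarrow>xs. [:- x, 1:]) = set xs"
proof -
  have monic: "(\<Prod>x\<leftarrow>xs. [:- x, 1:]) \<in> monics (length xs)" for xs :: "'a list"
  proof (induction xs)
    case (Cons x xs)
    have "[:- x, 1:] \<in> monics 1"
      by (simp add: monics_def)
    from mult_mem_monics[OF this Cons] show ?case
      by simp
  qed (simp add: monics_def)
  then show ?monic .
  show "coeff (\<Prod>x\<leftarrow>xs. [:- x, 1:]) n = - sum_list xs" if "length xs = Suc n"
    using that
  proof (induction xs arbitrary: n)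
    case (Cons x xs)
    let ?g = "\<Prod>x\<leftarrow>xs. [:- x, 1:]"
    have "coeff ?g n = 1"
      using monic[of xs] Cons.prems by (auto simp: monics_def)
    moreover have "coeff (pCons 0 ?g) n = - sum_list xs"
      using Cons by (cases n) auto
    ultimately show ?case
      by (simp add: mult_pCons_left)
  qed simp
  show "roots (\<Prod>x\<leftarrow>xs. [:- x, 1:]) = set xs"
    by (induction xs) auto
qed

lemma root_count_num_nonzero:
  fixes xs :: "'a::{finite,field} list"
  assumes m: "1 \<le> m" and xs: "length xs = m + 1" "sum_list xs = 0"
  shows "root_count_num (card (set xs)) (monom (1::'a) (m + 1)) (m - 1) \<noteq> 0"
proof -
  let ?F = "{f :: 'a poly. degree f = m + 1 \<and> coeff f m = 0 \<and> card (roots f) = card (set xs)}"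
  have "(\<Prod>x\<leftarrow>xs. [:- x, 1:]) \<in> ?F"
    using prod_list_linear[of xs] xs by (simp add: monics_def)
  moreover have "finite ?F"
    by (rule finite_subset[OF _ finite_degree_le[of "m + 1"]]) auto
  ultimately have "card ?F \<noteq> 0"
    by auto
  then show ?thesis
    unfolding card_degree_eq_card_roots[OF m] by simp
qed

lemma root_count_num_Suc_nonzero:
  assumes m: "1 \<le> m" "m + 2 \<le> CARD('a::{finite,field})"
    and ex: "even CARD('a) \<Longrightarrow> m \<noteq> 1 \<and> m \<noteq> CARD('a) - 3"
  shows "root_count_num (m + 1) (monom (1::'a) (m + 1)) (m - 1) \<noteq> 0"
proof -
  have "m + 1 \<noteq> 2 \<and> m + 1 \<noteq> CARD('a) - 2" if "even CARD('a)"
    using ex[OF that] m by auto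
  then obtain S :: "'a set" where S: "card S = m + 1" "\<Sum>S = 0"
    using ex_zero_sum_subset[of "m + 1", where 'a = 'a] m by auto
  obtain xs where xs: "set xs = S" "distinct xs"
    using finite_distinct_list[of S] by auto
  have "length xs = m + 1" "sum_list xs = 0"
    using S xs distinct_card[OF xs(2)] sum_list_distinct_conv_sum_set[OF xs(2), of "\<lambda>x. x"] by auto
  from root_count_num_nonzero[OF m(1) this] show ?thesis
    by (simp add: xs S)
qed

lemma root_count_num_same_nonzero:
  assumes m: "1 \<le> m" "m + 2 \<le> CARD('a::{finite,field})"
    and ex: "even CARD('a) \<Longrightarrow> m \<noteq> 3" "3 dvd CARD('a) \<Longrightarrow> m \<noteq> 2"
  shows "root_count_num m (monom (1::'a) (m + 1)) (m - 1) \<noteq> 0"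
proof -
  obtain S and y :: 'a where S: "card S = m" "y \<in> S" "y + \<Sum>S = 0"
    using ex_zero_sum_subset_double[where 'a = 'a] m ex by blast
  obtain xs where xs: "set xs = S" "distinct xs"
    using finite_distinct_list[of S] by auto
  have "length (y # xs) = m + 1" "sum_list (y # xs) = 0" "set (y # xs) = S"
    using S xs distinct_card[OF xs(2)] sum_list_distinct_conv_sum_set[OF xs(2), of "\<lambda>x. x"] by auto
  from root_count_num_nonzero[OF m(1) this(1,2)] show ?thesis
    unfolding \<open>set (y # xs) = S\<close> by (simp add: S)
qed

section \<open>Multiplicities and spectrum\<close>

lemma order_prod:
  fixes f :: "'a \<Rightarrow> 'b::idom poly"
  assumes "finite A" "\<And>a. a \<in> A \<Longrightarrow> f a \<noteq> 0"
  shows "order x (\<Prod>a\<in>A. f a) = (\<Sum>a\<in>A. order x (f a))"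
  using assms
proof (induction A rule: finite_induct)
  case (insert a A)
  then have "f a * (\<Prod>a\<in>A. f a) \<noteq> 0"
    by simp
  with insert show ?case
    by (simp add: order_mult)
qed simp

text \<open>The two roots merge for c = 0, whence the order 2.\<close>

lemma order_square_minus:
  "order x [:- c, 0, 1:] = (if c = x\<^sup>2 then if x = 0 then 2 else 1 else 0)" for c x :: real
proof (cases "c = x\<^sup>2")
  case True
  then have "[:- c, 0, 1:] = [:- x, 1:] * [:x, 1:]"
    by (simp add: power2_eq_square)
  moreover have "order x ([:- x, 1:] * [:x, 1:]) = order x [:- x, 1:] + order x [:x, 1:]"
    by (rule order_mult) simp
  ultimately show ?thesis
    using True by (simp add: order_linear')
next
  case False
  then show ?thesis
    by (simp add: order_0I power2_eq_square)
qed

lemma order_prod_square_minus: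
  fixes c :: "'a \<Rightarrow> real"
  assumes "finite A"
  shows "order x (\<Prod>a\<in>A. [:- c a, 0, 1:]) = (if x = 0 then 2 else 1) * card {a \<in> A. c a = x\<^sup>2}"
proof -
  have "order x (\<Prod>a\<in>A. [:- c a, 0, 1:]) = (\<Sum>a\<in>A. order x [:- c a, 0, 1:])"
    by (rule order_prod[OF assms]) simp
  also have "\<dots> = (\<Sum>a\<in>A. if c a = x\<^sup>2 then if x = 0 then 2 else 1 else 0)"
    by (simp only: order_square_minus)
  also have "\<dots> = (\<Sum>a\<in>{a \<in> A. c a = x\<^sup>2}. if x = 0 then 2 else 1)"
    by (rule sum.inter_filter[symmetric, OF assms])
  finally show ?thesis
    by simp
qed

text \<open>The value q comes from the zero polynomial. For i < m a product of i distinct linear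
  factors has degree below m and so lies in the family. For i = m and i = m + 1 only degree m + 1
  allows that many roots.\<close>

lemma card_roots_JW_poly_image:
  assumes m: "1 \<le> m" "m + 2 \<le> CARD('a::{finite,field})"
  shows "(\<lambda>a. card (roots (JW_poly m a :: 'a poly))) ` vecs (m + 1) =
    insert CARD('a) {i \<in> {0..m + 1}. i \<in> {m, m + 1} \<longrightarrow>
      root_count_num i (monom (1::'a) (m + 1)) (m - 1) \<noteq> 0}"
    (is "?r ` ?V = ?R")
proof -
  let ?F = "{f :: 'a poly. degree f \<le> m + 1 \<and> coeff f m = 0}"
  let ?N = "\<lambda>i. root_count_num i (monom (1::'a) (m + 1)) (m - 1)"
  have surj: "JW_poly m ` ?V = ?F"
    by (rule bij_betw_imp_surj_on[OF bij_betw_JW_poly[OF m(1)]])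
  have image: "?r ` ?V = (\<lambda>f. card (roots f)) ` ?F"
    unfolding surj[symmetric] by (simp add: image_image)
  have pos: "i \<in> ?r ` ?V \<longleftrightarrow> ?N i \<noteq> 0" if "i \<in> {m, m + 1}" for i
  proof -
    have card: "int (card {a \<in> ?V. ?r a = i}) = (int CARD('a) - 1) * int (?N i)"
      using card_JW_poly_card_roots[OF m(1), of i, where 'a = 'a] that m by auto
    have "int CARD('a) - 1 \<noteq> 0"
      using m by simp
    then have "int (card {a \<in> ?V. ?r a = i}) = 0 \<longleftrightarrow> ?N i = 0"
      unfolding card mult_eq_0_iff of_nat_eq_0_iff by simp
    then have "?N i = 0 \<longleftrightarrow> card {a \<in> ?V. ?r a = i} = 0"
      unfolding of_nat_eq_0_iff by (rule sym)
    also have "\<dots> \<longleftrightarrow> i \<notin> ?r ` ?V"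
      using finite_vecs[of "m + 1", where 'a = 'a] by (auto simp: card_eq_0_iff)
    finally show ?thesis
      by (simp only: not_not)
  qed
  show ?thesis
  proof (intro equalityI subsetI)
    fix i assume i: "i \<in> ?r ` ?V"
    then obtain f :: "'a poly" where f: "f \<in> ?F" "i = card (roots f)"
      unfolding image by blast
    show "i \<in> ?R"
    proof (cases "f = 0")
      case True
      with f show ?thesis
        by simp
    next
      case False
      with f have "i \<le> m + 1"
        using poly_roots_degree[OF False] by auto
      moreover have "?N i \<noteq> 0" if "i \<in> {m, m + 1}"
        using i unfolding pos[OF that] .
      ultimately show ?thesis
        by auto
    qed
  next
    fix i assume i: "i \<in> ?R"
    consider "i = CARD('a)" | "i \<in> {m, m + 1}" "?N i \<noteq> 0" | "i < m"
    proof (cases "i = CARD('a) \<or> i < m")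
      case False
      with i have "i \<le> m + 1" and N: "i \<in> {m, m + 1} \<longrightarrow> ?N i \<noteq> 0"
        by simp_all
      with False have "i \<in> {m, m + 1}"
        by auto
      with N that(2) show ?thesis
        by blast
    qed (use that in blast)
    then show "i \<in> ?r ` ?V"
    proof cases
      case 1
      have "i = card (roots (0 :: 'a poly))"
        using 1 by simp
      moreover have "0 \<in> ?F"
        by simp
      ultimately show ?thesis
        unfolding image by (rule image_eqI)
    next
      case 2
      then show ?thesis
        unfolding pos[OF 2(1)] by simp
    next
      case 3
      then obtain S :: "'a set" where S: "card S = i"
        using obtain_subset_with_card_n[of i "UNIV :: 'a set"] m by auto
      let ?f = "\<Prod>x\<in>S. [:- x, 1:]"
      have "degree ?f = i"
        using prod_linear_mem_monics[of S] S by (simp add: monics_def)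
      with 3 have "?f \<in> ?F"
        by (simp add: coeff_eq_0)
      moreover have "roots ?f = S"
        by (auto simp: poly_prod)
      then have "i = card (roots ?f)"
        by (simp only: S)
      ultimately show ?thesis
        unfolding image by (intro image_eqI)
    qed
  qed
qed

theorem theorem5p1:
  fixes m q :: nat
    and vs :: "((nat \<Rightarrow> 'a::{finite,field}) + (nat \<Rightarrow> 'a)) list"
    and A :: "real mat"
    and N :: "nat \<Rightarrow> nat"
    and M :: "nat \<Rightarrow> int"
  assumes q: "q = CARD('a)"
    and m: "1 \<le> m" "m + 1 \<le> q - 1"
    and vs: "distinct vs" "set vs = pverts (JW m)"
    and A: "A = adjacency_matrix (JW m) vs"
    and N: "\<And>i. N i = root_count_num i (monom (1::'a) (m + 1)) (m - 1)"
    and M: "\<And>i. M i =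
        (int q - 1) * int (q choose i) *
          (\<Sum>d = i..m - 1. \<Sum>k = 0..d - i.
             (-1) ^ k * int ((q - i) choose k) * int q ^ (d - i - k))
        + (int q - 1) * int (N i)"
  shows
    "(\<comment> \<open>outside the parameters where one of the prescribed multiplicities of the eigenvalues for
         \<open>i = m\<close> and \<open>i = m + 1\<close> is \<open>0\<close>\<close>
      \<not> (even q \<and> (m = 1 \<or> m = 3 \<or> m = q - 3)) \<and> \<not> (3 dvd q \<and> m = 2) \<longrightarrow>
        spectrum A = {real q, - real q}
          \<union> (\<Union>i\<in>{0..m + 1}. {sqrt (real (i * q)), - sqrt (real (i * q))}))
     \<and>
     (\<comment> \<open>for arbitrary parameters, without the listed numbers of multiplicity \<open>0\<close>\<close>
      spectrum A = {real q, - real q}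
        \<union> (\<Union>i\<in>{i \<in> {0..m + 1}. i \<in> {m, m + 1} \<longrightarrow> N i \<noteq> 0}.
             {sqrt (real (i * q)), - sqrt (real (i * q))}))
     \<and>
     (\<forall>i\<in>{1..m - 1}.
        int (order (sqrt (real (i * q))) (char_poly A)) = M i \<and>
        int (order (- sqrt (real (i * q))) (char_poly A)) = M i)
     \<and>
     (\<comment> \<open>for \<open>i = 0\<close> the two signs coincide, so that \<open>0\<close> is counted once for each sign\<close>
      int (order 0 (char_poly A)) = M 0 + M 0)
     \<and>
     (\<forall>i\<in>{m, m + 1}.
        int (order (sqrt (real (i * q))) (char_poly A)) = (int q - 1) * int (N i) \<and>
        int (order (- sqrt (real (i * q))) (char_poly A)) = (int q - 1) * int (N i))"
proof -
  let ?r = "\<lambda>a. card (roots (JW_poly m a :: 'a poly))"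
  let ?V = "vecs (m + 1) :: (nat \<Rightarrow> 'a) set"
  let ?R = "{i \<in> {0..m + 1}. i \<in> {m, m + 1} \<longrightarrow> N i \<noteq> 0}"
  have mq: "m + 2 \<le> CARD('a)" and q0: "0 < q"
    using m unfolding q by auto
  have cp: "char_poly A = (\<Prod>a\<in>?V. [:- real (q * ?r a), 0, 1:])"
    unfolding A q by (rule char_poly_JW[OF m(1) vs])
  \<comment> \<open>Since i <= m + 1 < q, the counting formula applies to \<open>i\<close>.\<close>
  have order: "int (order x (char_poly A)) = (if x = 0 then 2 else 1) * M i"
    if x: "x\<^sup>2 = real (i * q)" and i: "i \<le> m + 1" for x i
  proof -
    have "{a \<in> ?V. real (q * ?r a) = x\<^sup>2} = {a \<in> ?V. ?r a = i}"
      unfolding x of_nat_eq_iff using q0 by auto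
    moreover have "int (card {a \<in> ?V. ?r a = i}) = M i"
      unfolding M N q using i mq by (intro card_JW_poly_card_roots[OF m(1)]) auto
    ultimately show ?thesis
      unfolding cp order_prod_square_minus[OF finite_vecs] by simp
  qed
  have order_nz: "int (order x (char_poly A)) = M i"
    if "x = sqrt (real (i * q)) \<or> x = - sqrt (real (i * q))" "1 \<le> i" "i \<le> m + 1" for x i
  proof -
    have "x\<^sup>2 = real (i * q)" "x \<noteq> 0"
      using that q0 by auto
    with order[of x i] that show ?thesis
      by simp
  qed
  have M_top: "M i = (int q - 1) * int (N i)" if "i \<in> {m, m + 1}" for i
    using that m(1) unfolding M by auto
  have "A \<in> carrier_mat (length vs) (length vs)"
    unfolding A adjacency_matrix_def by simp
  then have "spectrum A = {x. poly (char_poly A) x = 0}"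
    by (rule spectrum_root_char_poly)
  also have "\<dots> = {x. \<exists>i\<in>?r ` ?V. x\<^sup>2 = real (i * q)}"
    unfolding cp by (auto simp: poly_prod prod_zero_iff finite_vecs power2_eq_square mult.commute)
  also have "?r ` ?V = insert q ?R"
    unfolding N q by (rule card_roots_JW_poly_image[OF m(1) mq])
  also have "{x. \<exists>i\<in>insert q ?R. x\<^sup>2 = real (i * q)} =
      {real q, - real q} \<union> (\<Union>i\<in>?R. {sqrt (real (i * q)), - sqrt (real (i * q))})"
  proof -
    have "x\<^sup>2 = real (i * q) \<longleftrightarrow> x \<in> {sqrt (real (i * q)), - sqrt (real (i * q))}" for x :: real and i
      using power2_eq_iff[of x "sqrt (real (i * q))"] by simp
    moreover have "sqrt (real (q * q)) = real q"
      by simp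
    ultimately show ?thesis
      by auto
  qed
  finally have spec: "spectrum A = {real q, - real q} \<union>
    (\<Union>i\<in>?R. {sqrt (real (i * q)), - sqrt (real (i * q))})" .
  have full: "?R = {0..m + 1}" if "\<not> (even q \<and> (m = 1 \<or> m = 3 \<or> m = q - 3)) \<and> \<not> (3 dvd q \<and> m = 2)"
  proof -
    have "N (m + 1) \<noteq> 0"
      unfolding N using that by (intro root_count_num_Suc_nonzero[OF m(1) mq]) (auto simp: q)
    moreover have "N m \<noteq> 0"
      unfolding N using that by (intro root_count_num_same_nonzero[OF m(1) mq]) (auto simp: q)
    ultimately show ?thesis
      by auto
  qed
  have "\<not> (even q \<and> (m = 1 \<or> m = 3 \<or> m = q - 3)) \<and> \<not> (3 dvd q \<and> m = 2) \<longrightarrow>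
      spectrum A = {real q, - real q} \<union> (\<Union>i\<in>{0..m + 1}. {sqrt (real (i * q)), - sqrt (real (i * q))})"
  proof
    assume c: "\<not> (even q \<and> (m = 1 \<or> m = 3 \<or> m = q - 3)) \<and> \<not> (3 dvd q \<and> m = 2)"
    show "spectrum A = {real q, - real q} \<union>
        (\<Union>i\<in>{0..m + 1}. {sqrt (real (i * q)), - sqrt (real (i * q))})"
      using spec unfolding full[OF c] .
  qed
  moreover have "\<forall>i\<in>{1..m - 1}.
      int (order (sqrt (real (i * q))) (char_poly A)) = M i \<and>
      int (order (- sqrt (real (i * q))) (char_poly A)) = M i"
    using order_nz by auto
  moreover have "int (order 0 (char_poly A)) = M 0 + M 0"
    using order[of 0 0] by simp
  moreover have "\<forall>i\<in>{m, m + 1}.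
      int (order (sqrt (real (i * q))) (char_poly A)) = (int q - 1) * int (N i) \<and>
      int (order (- sqrt (real (i * q))) (char_poly A)) = (int q - 1) * int (N i)"
  proof
    fix i assume i: "i \<in> {m, m + 1}"
    then have "1 \<le> i" "i \<le> m + 1"
      using m(1) by auto
    then show "int (order (sqrt (real (i * q))) (char_poly A)) = (int q - 1) * int (N i) \<and>
        int (order (- sqrt (real (i * q))) (char_poly A)) = (int q - 1) * int (N i)"
      unfolding M_top[OF i, symmetric] by (intro conjI order_nz) simp_all
  qed
  ultimately show ?thesis
    using spec by (intro conjI) assumption+
qed

end
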